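(* Let $(X;\mathbb A)$ be a CW $n$-ad and let $(Y;\mathbb B)$ have the homotopy type of a CW $n$-ad. Let $(Y;\mathbb B)^{(X;\mathbb A)}$ have the homotopy type of a CW complex. Assume that the homotopy groups of $Y$ are of cardinality at most $\aleph_\eta$, and that $X$ has $\aleph_\xi$ cells. Then $(Y;\mathbb B)^{(X;\mathbb A)}$ has at most $\aleph_\xi\times\aleph_\eta=\aleph_{\max\{\xi,\eta\}}$ path components. In particular, if $Y$ is a countable complex, then $(Y;\mathbb B)^{(X;\mathbb A)}$ has at most $\aleph_\xi$ path components.
   Context: A CW $n$-ad $(X;\mathbb A)=(X;A_1,\dots,A_n)$ is a CW complex $X$ with subcomplexes $A_1,\dots,A_n$. $(Y;\mathbb B)=(Y;B_1,\dots,B_n)$ has the homotopy type of a CW $n$-ad if it is homotopy equivalent to one by maps and homotopies respecting the distinguished subsets. $(Y;\mathbb B)^{(X;\mathbb A)}$ is the subspace of $Y^X$ (the space of continuous functions $X\to Y$ with the compact open topology) of maps $f$ with $f(A_i)\subset B_i$ for all $i$. A space $Y$ has homotopy groups of cardinality at most $\aleph_\eta$ if it has at most $\aleph_\eta$ path components and the homotopy groups of each path component have cardinality at most $\aleph_\eta$.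
   Formalization: In the first claim the bound on homotopy groups is also required of the intersections of Y with those B_i for which x lies in A_i (x in X); with a bound on Y alone it fails (Y a cone on an uncountable discrete B_1, A_1 a point of a countable discrete X). *)

theory Defs
  imports "HOL-Analysis.Analysis"
begin

unbundle cardinal_syntax

section \<open>CW complexes and CW n-ads\<close>

definition disc :: "nat \<Rightarrow> (nat \<Rightarrow> real) topology" where
  "disc k = subtopology (Euclidean_space k) {x. (\<Sum>i<k. (x i)\<^sup>2) \<le> 1}"

definition open_disc :: "nat \<Rightarrow> (nat \<Rightarrow> real) topology" where
  "open_disc k = subtopology (Euclidean_space k) {x. (\<Sum>i<k. (x i)\<^sup>2) < 1}"

text \<open>The boundary sphere of the \<open>k\<close>-disc; it is empty for \<open>k = 0\<close>, so \<open>nsphere\<close> does not fit.\<close>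

definition disc_boundary :: "nat \<Rightarrow> (nat \<Rightarrow> real) set" where
  "disc_boundary k = {x \<in> topspace (Euclidean_space k). (\<Sum>i<k. (x i)\<^sup>2) = 1}"

definition characteristic_map ::
  "'a topology \<Rightarrow> 'a set set \<Rightarrow> ('a set \<Rightarrow> nat) \<Rightarrow> 'a set \<Rightarrow> ((nat \<Rightarrow> real) \<Rightarrow> 'a) \<Rightarrow> bool" where
  "characteristic_map X E d e \<Phi> \<longleftrightarrow>
     continuous_map (disc (d e)) X \<Phi> \<and>
     homeomorphic_map (open_disc (d e)) (subtopology X e) \<Phi> \<and>
     (\<exists>F\<subseteq>E. finite F \<and> (\<forall>c\<in>F. d c < d e) \<and> \<Phi> ` disc_boundary (d e) \<subseteq> \<Union>F)"

text \<open>\<open>E\<close> is the set of open cells and \<open>d\<close> assigns to each cell its dimension.  The second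
  and third lines together contain closure finiteness, the last line is the weak topology.\<close>

definition cw_complex :: "'a topology \<Rightarrow> 'a set set \<Rightarrow> ('a set \<Rightarrow> nat) \<Rightarrow> bool" where
  "cw_complex X E d \<longleftrightarrow>
     Hausdorff_space X \<and>
     \<Union>E = topspace X \<and> disjoint E \<and>
     (\<forall>e\<in>E. \<exists>\<Phi>. characteristic_map X E d e \<Phi>) \<and>
     (\<forall>C\<subseteq>topspace X. (\<forall>e\<in>E. closedin X (C \<inter> X closure_of e)) \<longrightarrow> closedin X C)"

definition subcomplex :: "'a topology \<Rightarrow> 'a set set \<Rightarrow> 'a set \<Rightarrow> bool" where
  "subcomplex X E A \<longleftrightarrow> (\<exists>F\<subseteq>E. A = \<Union>F \<and> (\<forall>e\<in>F. X closure_of e \<subseteq> A))"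

text \<open>The distinguished subsets of an n-ad are \<open>A 0, \<dots>, A (n - 1)\<close>; the values of \<open>A\<close> at
  indices \<open>\<ge> n\<close> are irrelevant.\<close>

definition cw_nad ::
  "'a topology \<Rightarrow> 'a set set \<Rightarrow> ('a set \<Rightarrow> nat) \<Rightarrow> nat \<Rightarrow> (nat \<Rightarrow> 'a set) \<Rightarrow> bool" where
  "cw_nad X E d n A \<longleftrightarrow> cw_complex X E d \<and> (\<forall>i<n. subcomplex X E (A i))"

section \<open>Maps and homotopies of n-ads\<close>

definition nad :: "'a topology \<Rightarrow> nat \<Rightarrow> (nat \<Rightarrow> 'a set) \<Rightarrow> bool" where
  "nad X n A \<longleftrightarrow> (\<forall>i<n. A i \<subseteq> topspace X)"

definition preserves_nad :: "nat \<Rightarrow> (nat \<Rightarrow> 'a set) \<Rightarrow> (nat \<Rightarrow> 'b set) \<Rightarrow> ('a \<Rightarrow> 'b) \<Rightarrow> bool" where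
  "preserves_nad n A B f \<longleftrightarrow> (\<forall>i<n. f ` A i \<subseteq> B i)"

definition nad_homotopy_equivalent ::
  "nat \<Rightarrow> 'a topology \<Rightarrow> (nat \<Rightarrow> 'a set) \<Rightarrow> 'b topology \<Rightarrow> (nat \<Rightarrow> 'b set) \<Rightarrow> bool" where
  "nad_homotopy_equivalent n X A Y B \<longleftrightarrow>
     (\<exists>f g. continuous_map X Y f \<and> preserves_nad n A B f \<and>
            continuous_map Y X g \<and> preserves_nad n B A g \<and>
            homotopic_with (preserves_nad n A A) X X (g \<circ> f) id \<and>
            homotopic_with (preserves_nad n B B) Y Y (f \<circ> g) id)"

text \<open>The homotopy type of a CW n-ad, respectively of a CW complex.  HOL cannot quantify over
  types, so the type \<open>'v\<close> of points of the complex is a parameter; as a hypothesis with \<open>'v\<close> a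
  type variable, this says that such a complex exists over some type.\<close>

definition has_cw_nad_type ::
  "'v itself \<Rightarrow> nat \<Rightarrow> 'b topology \<Rightarrow> (nat \<Rightarrow> 'b set) \<Rightarrow> bool" where
  "has_cw_nad_type T n Y B \<longleftrightarrow>
     (\<exists>(V :: 'v topology) E d C. cw_nad V E d n C \<and> nad_homotopy_equivalent n Y B V C)"

definition has_cw_type :: "'v itself \<Rightarrow> 'b topology \<Rightarrow> bool" where
  "has_cw_type T Y \<longleftrightarrow>
     (\<exists>(V :: 'v topology) E d. cw_complex V E d \<and> Y homotopy_equivalent_space V)"

section \<open>Function spaces with the compact-open topology\<close>

text \<open>Maps are made \<open>extensional\<close> so that each continuous map is represented by one function.\<close>

definition continuous_maps :: "'a topology \<Rightarrow> 'b topology \<Rightarrow> ('a \<Rightarrow> 'b) set" where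
  "continuous_maps X Y = {f \<in> extensional (topspace X). continuous_map X Y f}"

definition compact_open_topology :: "'a topology \<Rightarrow> 'b topology \<Rightarrow> ('a \<Rightarrow> 'b) topology" where
  "compact_open_topology X Y =
     topology_generated_by
       {{f \<in> continuous_maps X Y. f ` K \<subseteq> U} | K U. compactin X K \<and> openin Y U}"

definition nad_maps ::
  "nat \<Rightarrow> 'a topology \<Rightarrow> (nat \<Rightarrow> 'a set) \<Rightarrow> 'b topology \<Rightarrow> (nat \<Rightarrow> 'b set) \<Rightarrow> ('a \<Rightarrow> 'b) topology" where
  "nad_maps n X A Y B = subtopology (compact_open_topology X Y) {f. preserves_nad n A B f}"

text \<open>The subspace of \<open>Y\<close> in which a map of n-ads takes its value at \<open>x\<close>.  It is \<open>Y\<close> itself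
  if \<open>x\<close> lies in none of the \<open>A i\<close>.  Counting components of \<open>nad_maps\<close> requires a bound on the
  homotopy groups of these subspaces, a bound for \<open>Y\<close> alone is not enough: let \<open>X\<close> be countable
  discrete, \<open>A 0\<close> a single point, \<open>B 0\<close> uncountable discrete and \<open>Y\<close> the cone on \<open>B 0\<close>.  Then
  \<open>Y\<close> is contractible, but the space of maps is homotopy equivalent to \<open>B 0\<close>.\<close>

definition nad_target ::
  "nat \<Rightarrow> (nat \<Rightarrow> 'a set) \<Rightarrow> 'b topology \<Rightarrow> (nat \<Rightarrow> 'b set) \<Rightarrow> 'a \<Rightarrow> 'b topology" where
  "nad_target n A Y B x = subtopology Y {y. \<forall>i<n. x \<in> A i \<longrightarrow> y \<in> B i}"

section \<open>Homotopy groups\<close>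

definition cube :: "nat \<Rightarrow> (nat \<Rightarrow> real) topology" where
  "cube k = product_topology (\<lambda>i. top_of_set {0..1}) {..<k}"

definition cube_boundary :: "nat \<Rightarrow> (nat \<Rightarrow> real) set" where
  "cube_boundary k = {x \<in> topspace (cube k). \<exists>i<k. x i = 0 \<or> x i = 1}"

text \<open>The underlying set of the \<open>k\<close>-th homotopy group of \<open>Y\<close> at \<open>y\<close>: maps of pairs from the
  \<open>k\<close>-cube and its boundary to \<open>Y\<close> and \<open>y\<close>, up to homotopy relative to the boundary.  Functions
  that differ only outside the cube lie in the same class.\<close>

definition cube_loops :: "nat \<Rightarrow> 'b topology \<Rightarrow> 'b \<Rightarrow> ((nat \<Rightarrow> real) \<Rightarrow> 'b) set" where
  "cube_loops k Y y = {f. continuous_map (cube k) Y f \<and> f ` cube_boundary k \<subseteq> {y}}"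

definition homotopy_group :: "nat \<Rightarrow> 'b topology \<Rightarrow> 'b \<Rightarrow> ((nat \<Rightarrow> real) \<Rightarrow> 'b) set set" where
  "homotopy_group k Y y =
     cube_loops k Y y //
       {(f, g). f \<in> cube_loops k Y y \<and> g \<in> cube_loops k Y y \<and>
                homotopic_with (\<lambda>h. h ` cube_boundary k \<subseteq> {y}) (cube k) Y f g}"

definition homotopy_groups_le :: "'b topology \<Rightarrow> 'c rel \<Rightarrow> bool" where
  "homotopy_groups_le Y \<kappa> \<longleftrightarrow>
     |path_components_of Y| \<le>o \<kappa> \<and>
     (\<forall>C\<in>path_components_of Y. \<forall>y\<in>C. \<forall>k\<ge>1. |homotopy_group k (subtopology Y C) y| \<le>o \<kappa>)"

section \<open>Alephs\<close>

text \<open>\<open>is_aleph \<xi> \<kappa>\<close>: the infinite cardinal \<open>\<kappa>\<close> is the aleph indexed by the ordinal \<open>\<xi>\<close>.  Cardinals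
  are initial well-orders, so an infinite cardinal below \<open>\<kappa>\<close> is a proper initial segment of \<open>\<kappa>\<close>
  that is itself an infinite cardinal; \<open>\<xi>\<close> is the order type of the set of these.\<close>

definition is_aleph :: "'o rel \<Rightarrow> 'c rel \<Rightarrow> bool" where
  "is_aleph \<xi> \<kappa> \<longleftrightarrow>
     Cinfinite \<kappa> \<and> Well_order \<xi> \<and>
     Restr \<kappa> {a \<in> Field \<kappa>. Cinfinite (Restr \<kappa> (underS \<kappa> a))} =o \<xi>"

definition ord_max :: "'o rel \<Rightarrow> 'o rel \<Rightarrow> 'o rel" where
  "ord_max \<xi> \<eta> = (if \<xi> \<le>o \<eta> then \<eta> else \<xi>)"

end

theory Submission
  imports Defs
begin

text \<open>
  Path components of a space of the homotopy type of a CW complex are open.  A component \<open>C\<close> of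
  the mapping space therefore contains, with some \<open>f\<close>, all maps that agree with \<open>f\<close> on a suitable
  finite subcomplex \<open>K\<close>.  If \<open>f\<close> is homotopic on \<open>K\<close> to a map in another component with the same
  \<open>K\<close>, the homotopy extension property shows that the two components coincide.  So components
  inject into pairs of a finite subcomplex, \<open>\<kappa>\<close> in number, and a homotopy class of maps on it.
  Adding the cells of \<open>K\<close> one by one bounds these classes by \<open>\<mu>\<close>: maps on a disc with the same
  boundary values are classified by their difference in a homotopy group.

  If \<open>Y\<close> is a countable complex, a bound for the homotopy groups of the subspaces of \<open>Y\<close> is not
  at hand.  Instead, CW complexes have networks for compact sets whose size is the number of cells;
  they yield a network of size \<open>\<kappa>\<close> of the mapping space, and disjoint open sets are at most \<open>\<kappa>\<close>.
\<close>

section \<open>Cardinals and alephs\<close>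

text \<open>A homotopy group enters the count only as a set: maps on a disc that agree on the
  boundary and have the same difference class relative to a reference map are homotopic relative to
  the boundary. This asks for a passage between cubes, which carry homotopy groups, and discs, which
  carry cells. Explicit rescalings with room to spare replace a homeomorphism: the boundary of the
  cube only has to land where the glued map is constant. For an infinite \<open>X\<close> the
  product with an interval is the obstacle. The extended homotopy is therefore defined pointwise, by
  recursion on the dimension of the cell containing the point, with no order of attachment; and its
  continuity is tested only over finite subcomplexes, which contain all compact sets and so all that
  the compact-open topology sees. A subcomplex that meets an open cell contains the closed cell.
  Hence a map of n-ads sends a whole closed cell into the one space \<open>nad_target\<close> at its
  centre, and the groups of that space count the maps on the cell.\<close>

lemma countable_card_of_ordLeq:
  assumes "Cinfinite r" "countable A"
  shows "|A| \<le>o r"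
proof -
  have "|A| \<le>o |UNIV :: nat set|"
    using assms(2) card_of_ordLeq by (metis countable_def subset_UNIV)
  then show ?thesis
    using assms(1) natLeq_ordLeq_cinfinite card_of_nat ordIso_ordLeq_trans ordLeq_transitive by blast
qed

lemma card_of_singleton_ordLeq:
  assumes "Cinfinite r"
  shows "|{a}| \<le>o r"
  using assms by (simp add: countable_card_of_ordLeq)

text \<open>Finite subsets are sorted by size: one of size \<open>Suc n\<close> is a point added to
  one of size \<open>n\<close>, and the countably many layers are each bounded by the infinite
  cardinal \<open>r\<close>.\<close>

lemma card_of_Fpow_ordLeq:
  fixes A :: "'a set"
  assumes r: "Cinfinite r" and A: "|A| \<le>o r"
  shows "|Fpow A| \<le>o r"
proof -
  have le: "|{B. B \<subseteq> A \<and> finite B \<and> card B = n}| \<le>o r" for n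
  proof (induction n)
    case 0
    have "{B. B \<subseteq> A \<and> finite B \<and> card B = 0} = {{}}" by auto
    moreover have "|{{} :: 'a set}| \<le>o r"
      by (rule card_of_singleton_ordLeq[OF r])
    ultimately show ?case by (simp only:)
  next
    case (Suc n)
    let ?F = "{B. B \<subseteq> A \<and> finite B \<and> card B = n}"
    have sub: "{B. B \<subseteq> A \<and> finite B \<and> card B = Suc n} \<subseteq> (\<lambda>(a, B). insert a B) ` (A \<times> ?F)"
    proof
      fix B assume B: "B \<in> {B. B \<subseteq> A \<and> finite B \<and> card B = Suc n}"
      then obtain b C where "B = insert b C" "b \<notin> C" "card C = n"
        by (auto simp: card_Suc_eq)
      with B show "B \<in> (\<lambda>(a, B). insert a B) ` (A \<times> ?F)"
        by (auto intro!: image_eqI[where x = "(b, C)"])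
    qed
    have "|A \<times> ?F| \<le>o r"
      using A Suc r by (intro card_of_Times_ordLeq_infinite_Field) (auto simp: cinfinite_def)
    with sub show ?case
      by (meson card_of_image card_of_mono1 ordLeq_transitive)
  qed
  have "Fpow A = (\<Union>n::nat. {B. B \<subseteq> A \<and> finite B \<and> card B = n})"
    by (auto simp: Fpow_def)
  moreover have "|UNIV :: nat set| \<le>o r"
    using r natLeq_ordLeq_cinfinite card_of_nat ordIso_ordLeq_trans by blast
  ultimately show ?thesis
    using le r by (auto intro: UNION_Cinfinite_bound)
qed

lemma card_of_ordLeq_inj:
  assumes "inj_on f A" "f ` A \<subseteq> B" "|B| \<le>o r"
  shows "|A| \<le>o r"
proof -
  have "|A| \<le>o |B|"
    using assms(1,2) card_of_ordLeq by blast
  then show ?thesis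
    using assms(3) by (rule ordLeq_transitive)
qed

text \<open>Turns a bound on the values of an invariant into a bound on a set of actual maps that
  meets every class. The values will be path components and homotopy classes.\<close>

lemma representatives_ordLeq:
  assumes "|f ` A| \<le>o r"
  obtains S where "S \<subseteq> A" "|S| \<le>o r" "\<And>a. a \<in> A \<Longrightarrow> \<exists>s\<in>S. f s = f a"
proof
  show "inv_into A f ` f ` A \<subseteq> A"
    by (auto intro: inv_into_into)
  show "|inv_into A f ` f ` A| \<le>o r"
    using assms card_of_image ordLeq_transitive by blast
  show "\<exists>s\<in>inv_into A f ` f ` A. f s = f a" if "a \<in> A" for a
    using that by (auto simp: f_inv_into_f)
qed

section \<open>The index of an aleph as an order type\<close>

definition aleph_points :: "'a rel \<Rightarrow> 'a set" where
  "aleph_points r = {a \<in> Field r. Cinfinite (Restr r (underS r a))}"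

text \<open>An embedding carries the strict initial segment below \<open>a\<close> onto the one
  below \<open>f a\<close>. Since \<open>aleph_points\<close> looks only at the isomorphism type of
  that segment, membership is invariant under embeddings.\<close>

lemma embed_Restr_underS_ordIso:
  assumes r: "Well_order r" and r': "Well_order r'" and f: "embed r r' f" and a: "a \<in> Field r"
  shows "Restr r (underS r a) =o Restr r' (underS r' (f a))"
proof -
  have fa: "f a \<in> Field r'"
    using a f embed_in_Field by fastforce
  have iff: "(x, y) \<in> r \<longleftrightarrow> (f x, f y) \<in> r'" if "x \<in> Field r" "y \<in> Field r" for x y
    using embed_implies_iso_Restr[OF r' r f] that unfolding iso_iff2 by auto
  have F: "Field (Restr r (underS r a)) = underS r a"
    using Field_Restr_ofilter[OF r wo_rel.underS_ofilter] r unfolding wo_rel_def by simp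
  have F': "Field (Restr r' (underS r' (f a))) = underS r' (f a)"
    using Field_Restr_ofilter[OF r' wo_rel.underS_ofilter] r' unfolding wo_rel_def by simp
  have sub: "underS r a \<subseteq> Field r"
    by (auto simp: underS_def Field_def)
  have bij: "bij_betw f (underS r a) (underS r' (f a))"
    using embed_underS[OF r f a] .
  have "iso (Restr r (underS r a)) (Restr r' (underS r' (f a))) f"
    unfolding iso_iff2 F F'
  proof (intro conjI ballI)
    fix x y assume xy: "x \<in> underS r a" "y \<in> underS r a"
    then have "x \<in> Field r" "y \<in> Field r"
      using sub by blast+
    moreover have "f x \<in> underS r' (f a)" "f y \<in> underS r' (f a)"
      using bij xy by (auto simp: bij_betw_def)
    ultimately show "(x, y) \<in> Restr r (underS r a) \<longleftrightarrow> (f x, f y) \<in> Restr r' (underS r' (f a))"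
      using xy iff by simp
  qed (use bij in auto)
  then show ?thesis
    unfolding ordIso_def using Well_order_Restr[OF r] Well_order_Restr[OF r'] by auto
qed

lemma embed_aleph_points_iff:
  assumes r: "Well_order r" and r': "Well_order r'" and f: "embed r r' f" and a: "a \<in> Field r"
  shows "f a \<in> aleph_points r' \<longleftrightarrow> a \<in> aleph_points r"
proof -
  have iso: "Restr r (underS r a) =o Restr r' (underS r' (f a))"
    by (rule embed_Restr_underS_ordIso[OF assms])
  have "Cinfinite (Restr r (underS r a)) \<longleftrightarrow> Cinfinite (Restr r' (underS r' (f a)))"
    using Cinfinite_cong[OF iso] Cinfinite_cong[OF ordIso_symmetric[OF iso]] by blast
  then show ?thesis
    using embed_in_Field[OF f a] a by (simp add: aleph_points_def)
qed

lemma Field_Restr_aleph_points: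
  "Well_order r \<Longrightarrow> Field (Restr r (aleph_points r)) = aleph_points r"
  by (rule Refl_Field_Restr2) (auto simp: aleph_points_def order_on_defs)

text \<open>Initial segments of the restricted orders are initial segments cut down to the aleph
  points, and \<open>f\<close> matches these points. So an embedding of cardinals induces one of the
  orders whose types are the indices.\<close>

lemma embed_Restr_aleph_points:
  assumes r: "Well_order r" and r': "Well_order r'" and f: "embed r r' f"
  shows "embed (Restr r (aleph_points r)) (Restr r' (aleph_points r')) f"
  unfolding embed_def Field_Restr_aleph_points[OF r]
proof
  fix a assume a: "a \<in> aleph_points r"
  then have aF: "a \<in> Field r"
    by (auto simp: aleph_points_def)
  have bij: "bij_betw f (under r a) (under r' (f a))"
    using f aF by (auto simp: embed_def)
  have 1: "under (Restr r (aleph_points r)) a = under r a \<inter> aleph_points r"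
    using a by (auto simp: under_def)
  have 2: "under (Restr r' (aleph_points r')) (f a) = under r' (f a) \<inter> aleph_points r'"
    using a embed_aleph_points_iff[OF assms aF] by (auto simp: under_def)
  have "c \<in> under r a \<Longrightarrow> f c \<in> aleph_points r' \<longleftrightarrow> c \<in> aleph_points r" for c
    by (rule embed_aleph_points_iff[OF assms]) (auto simp: under_def Field_def)
  then show "bij_betw f (under (Restr r (aleph_points r)) a)
      (under (Restr r' (aleph_points r')) (f a))"
    unfolding 1 2 using bij by (fastforce simp: bij_betw_def inj_on_def)
qed

lemma is_aleph_iff:
  "is_aleph \<xi> \<kappa> \<longleftrightarrow> Cinfinite \<kappa> \<and> Well_order \<xi> \<and> Restr \<kappa> (aleph_points \<kappa>) =o \<xi>"
  by (simp add: is_aleph_def aleph_points_def)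

lemma Cinfinite_Well_order: "Cinfinite r \<Longrightarrow> Well_order r"
  by (auto simp: card_order_on_def)

text \<open>The smaller cardinal is isomorphic to the segment of \<open>\<mu>\<close> below some
  \<open>b\<close>. This \<open>b\<close> is then an aleph point of \<open>\<mu>\<close> outside the
  image of \<open>\<kappa>\<close>, so the induced embedding of the index orders is proper.\<close>

lemma is_aleph_strict_mono:
  assumes al: "is_aleph \<xi> \<kappa>" "is_aleph \<eta> \<mu>" and less: "\<kappa> <o \<mu>"
  shows "\<xi> <o \<eta>"
proof -
  have W: "Well_order \<kappa>" "Well_order \<mu>"
    using al by (simp_all add: is_aleph_iff Cinfinite_Well_order)
  obtain f where f: "embedS \<kappa> \<mu> f"
    using less by (auto simp: ordLess_def)
  then have e: "embed \<kappa> \<mu> f"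
    by (simp add: embedS_def)
  have ne: "f ` Field \<kappa> \<subset> Field \<mu>"
    using embedS_Field[OF W(1) f] .
  have "wo_rel \<mu>"
    using W(2) by (simp add: wo_rel_def)
  then have "(\<exists>b\<in>Field \<mu>. f ` Field \<kappa> = underS \<mu> b) \<or> f ` Field \<kappa> = Field \<mu>"
    using embed_Field_ofilter[OF W e] by (simp only: wo_rel.ofilter_underS_Field)
  then obtain b where b: "b \<in> Field \<mu>" "f ` Field \<kappa> = underS \<mu> b"
    using ne by auto
  have "\<kappa> =o Restr \<mu> (underS \<mu> b)"
    using embed_implies_iso_Restr[OF W(2,1) e] W(1) Well_order_Restr[OF W(2)]
    unfolding ordIso_def b(2) by auto
  then have bal: "b \<in> aleph_points \<mu>"
    using al(1) b(1) Cinfinite_cong by (auto simp: aleph_points_def is_aleph_iff)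
  have "b \<notin> f ` Field \<kappa>"
    using b(2) by (auto simp: underS_def)
  then have "b \<notin> f ` aleph_points \<kappa>"
    by (auto simp: aleph_points_def)
  moreover have "f ` aleph_points \<kappa> \<subseteq> aleph_points \<mu>"
    using embed_aleph_points_iff[OF W e] by (auto simp: aleph_points_def[of \<kappa>])
  ultimately have "f ` aleph_points \<kappa> \<subset> aleph_points \<mu>"
    using bal by blast
  then have "embedS (Restr \<kappa> (aleph_points \<kappa>)) (Restr \<mu> (aleph_points \<mu>)) f"
    using embedS_iff[OF Well_order_Restr[OF W(1)] embed_Restr_aleph_points[OF W e]] W
    by (simp add: Field_Restr_aleph_points)
  then have "Restr \<kappa> (aleph_points \<kappa>) <o Restr \<mu> (aleph_points \<mu>)"
    unfolding ordLess_def using Well_order_Restr[OF W(1)] Well_order_Restr[OF W(2)] by auto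
  then show ?thesis
    using al unfolding is_aleph_iff
    by (meson ordIso_ordLess_trans ordIso_symmetric ordLess_ordIso_trans)
qed

lemma Restr_aleph_points_ordLeq:
  assumes "r \<le>o s"
  shows "Restr r (aleph_points r) \<le>o Restr s (aleph_points s)"
proof -
  obtain f where "Well_order r" "Well_order s" "embed r s f"
    using assms by (auto simp: ordLeq_def)
  then show ?thesis
    unfolding ordLeq_def by (auto intro!: Well_order_Restr exI embed_Restr_aleph_points)
qed

lemma is_aleph_mono:
  assumes "is_aleph \<xi> \<kappa>" "is_aleph \<eta> \<mu>" "\<kappa> \<le>o \<mu>"
  shows "\<xi> \<le>o \<eta>"
  using assms(1,2) Restr_aleph_points_ordLeq[OF assms(3)] unfolding is_aleph_iff
  by (meson ordIso_ordLeq_trans ordIso_symmetric ordLeq_ordIso_trans)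

lemma is_aleph_ordIso:
  fixes \<kappa> :: "'c rel" and \<nu> :: "'d rel"
  assumes "is_aleph \<xi> \<kappa>" "\<kappa> =o \<nu>"
  shows "is_aleph \<xi> \<nu>"
proof -
  have C: "Cinfinite \<nu>"
    using assms Cinfinite_cong by (auto simp: is_aleph_iff)
  have "Restr \<kappa> (aleph_points \<kappa>) =o Restr \<nu> (aleph_points \<nu>)"
    using assms(2) by (simp add: ordIso_iff_ordLeq Restr_aleph_points_ordLeq)
  then show ?thesis
    using assms(1) C unfolding is_aleph_iff by (meson ordIso_symmetric ordIso_transitive)
qed

text \<open>An infinite product is the larger factor, while \<open>ord_max\<close> compares the
  indices. The two choices agree because the index is monotone (case
  \<open>\<kappa> \<le>o \<mu>\<close>) and strictly monotone (the other case).\<close>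

lemma is_aleph_cprod:
  assumes "is_aleph \<xi> \<kappa>" "is_aleph \<eta> \<mu>"
  shows "is_aleph (ord_max \<xi> \<eta>) (\<kappa> *c \<mu>)"
proof -
  have C: "Cinfinite \<kappa>" "Cinfinite \<mu>" and W: "Well_order \<kappa>" "Well_order \<mu>"
    using assms by (simp_all add: is_aleph_iff Cinfinite_Well_order)
  show ?thesis
  proof (cases "\<kappa> \<le>o \<mu>")
    case True
    have "\<mu> =o \<kappa> *c \<mu>"
      using cprod_infinite2'[OF Cinfinite_Cnotzero[OF C(1)] C(2) True] ordIso_symmetric by blast
    with True show ?thesis
      using assms is_aleph_mono is_aleph_ordIso by (fastforce simp: ord_max_def)
  next
    case False
    then have less: "\<mu> <o \<kappa>"
      using W not_ordLeq_iff_ordLess by blast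
    then have "\<not> \<xi> \<le>o \<eta>"
      using is_aleph_strict_mono[OF assms(2,1)] not_ordLess_ordLeq by blast
    moreover have "\<kappa> =o \<kappa> *c \<mu>"
      using cprod_infinite1'[OF C(1) Cinfinite_Cnotzero[OF C(2)]] less ordIso_symmetric
        ordLess_imp_ordLeq by blast
    ultimately show ?thesis
      using assms(1) is_aleph_ordIso by (auto simp: ord_max_def)
  qed
qed

section \<open>Discs\<close>

text \<open>Stated for one function \<open>h\<close> on the whole space: agreement on the overlap
  then reduces to showing that \<open>h\<close> is given by the intended formula on each closed
  piece, rim included.\<close>

lemma continuous_map_paste:
  assumes "closedin X A" "closedin X B" "topspace X \<subseteq> A \<union> B"
    and "continuous_map (subtopology X A) Z h" "continuous_map (subtopology X B) Z h"
  shows "continuous_map X Z h"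
  by (rule pasting_lemma_closed[where I = "UNIV :: bool set" and T = "\<lambda>b. if b then A else B" and f = "\<lambda>_. h"])
    (use assms in \<open>auto split: if_splits\<close>)

lemma continuous_map_compose_on:
  assumes "continuous_map (top_of_set T) Z g" "continuous_on S f" "f ` S \<subseteq> T"
  shows "continuous_map (top_of_set S) Z (\<lambda>x. g (f x))"
  using continuous_map_compose[of "top_of_set S" "top_of_set T" f Z g] assms
  by (auto simp: o_def)

section \<open>Norm, compactness and connectedness of discs\<close>

abbreviation vnorm :: "nat \<Rightarrow> (nat \<Rightarrow> real) \<Rightarrow> real" where
  "vnorm k x \<equiv> L2_set x {..<k}"

text \<open>Points of \<open>k\<close>-space are real sequences that vanish from index
  \<open>k\<close> on, so discs of all dimensions are subsets of one type and the class-based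
  notions of continuity and compactness apply to them.\<close>

definition vspace :: "nat \<Rightarrow> (nat \<Rightarrow> real) set" where
  "vspace k = {x. \<forall>i\<ge>k. x i = 0}"

definition disc_set :: "nat \<Rightarrow> (nat \<Rightarrow> real) set" where
  "disc_set k = {x \<in> vspace k. vnorm k x \<le> 1}"

lemma Euclidean_space_eq: "Euclidean_space k = top_of_set (vspace k)"
  by (simp add: Euclidean_space_def vspace_def euclidean_product_topology)

lemma disc_eq: "disc k = top_of_set (disc_set k)"
proof -
  have "vspace k \<inter> {x. (\<Sum>i<k. (x i)\<^sup>2) \<le> 1} = disc_set k"
    by (auto simp: disc_set_def L2_set_def)
  then show ?thesis
    by (simp add: disc_def Euclidean_space_eq subtopology_subtopology)
qed

lemma open_disc_eq: "open_disc k = top_of_set {x \<in> vspace k. vnorm k x < 1}"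
proof -
  have "vspace k \<inter> {x. (\<Sum>i<k. (x i)\<^sup>2) < 1} = {x \<in> vspace k. vnorm k x < 1}"
    by (auto simp: L2_set_def)
  then show ?thesis
    by (simp add: open_disc_def Euclidean_space_eq subtopology_subtopology)
qed

lemma disc_boundary_eq: "disc_boundary k = {x \<in> vspace k. vnorm k x = 1}"
  by (auto simp: disc_boundary_def Euclidean_space_eq L2_set_def)

lemma topspace_disc [simp]: "topspace (disc k) = disc_set k"
  by (simp add: disc_eq)

lemma disc_boundary_subset: "disc_boundary k \<subseteq> disc_set k"
  by (auto simp: disc_boundary_eq disc_set_def)

lemma continuous_on_vnorm [continuous_intros]:
  assumes "continuous_on S f"
  shows "continuous_on S (\<lambda>x. vnorm k (f x))"
proof -
  have "continuous_on S (\<lambda>x. f x i)" for i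
    using assms by (rule continuous_on_product_then_coordinatewise)
  then show ?thesis
    unfolding L2_set_def by (intro continuous_intros)
qed

lemma continuous_on_vscale [continuous_intros]:
  assumes "continuous_on S c" "continuous_on S f"
  shows "continuous_on S (\<lambda>x i. c x * (f x i :: real))"
proof -
  have "continuous_on S (\<lambda>x. f x i)" for i
    using assms(2) by (rule continuous_on_product_then_coordinatewise)
  then show ?thesis
    using assms(1) by (intro continuous_intros)
qed

lemma vnorm_scale: "vnorm k (\<lambda>i. c * x i) = \<bar>c\<bar> * vnorm k x"
proof -
  have "vnorm k (\<lambda>i. c * x i) = vnorm k (\<lambda>i. \<bar>c\<bar> * x i)"
    by (simp add: L2_set_def power_mult_distrib)
  then show ?thesis
    by (simp add: L2_set_right_distrib)
qed

lemma vspace_scale: "x \<in> vspace k \<Longrightarrow> (\<lambda>i. c * x i) \<in> vspace k"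
  by (simp add: vspace_def)

lemma abs_le_vnorm:
  assumes "i < k"
  shows "\<bar>x i\<bar> \<le> vnorm k x"
proof -
  have "\<bar>x i\<bar> = sqrt ((x i)\<^sup>2)" by simp
  also have "\<dots> \<le> vnorm k x"
    unfolding L2_set_def using assms by (intro real_sqrt_le_mono member_le_sum) auto
  finally show ?thesis .
qed

lemma vnorm_nonneg: "0 \<le> vnorm k x"
  by (rule L2_set_nonneg)

lemma zero_in_disc_set: "(\<lambda>i. 0) \<in> disc_set k"
  by (simp add: disc_set_def vspace_def L2_set_def)

lemma disc_set_scale: "x \<in> disc_set k \<Longrightarrow> \<bar>c\<bar> \<le> 1 \<Longrightarrow> (\<lambda>i. c * x i) \<in> disc_set k"
  by (auto simp: disc_set_def vspace_scale vnorm_scale mult_le_one vnorm_nonneg)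

lemma closed_vspace: "closed (vspace k)"
proof -
  have "vspace k = (\<Inter>i\<in>{k..}. {x. x i = 0})"
    by (auto simp: vspace_def)
  then show ?thesis
    by (auto intro!: closed_Collect_eq)
qed

text \<open>The disc is closed in the product of countably many intervals \<open>{-1..1}\<close>,
  which is compact by Tychonoff: coordinates from \<open>k\<close> on vanish and the others are
  bounded by the norm.\<close>

lemma compact_disc_set: "compact (disc_set k)"
proof -
  have "compactin (product_topology (\<lambda>i. euclideanreal) UNIV) (PiE UNIV (\<lambda>i :: nat. {-1..1 :: real}))"
    by (simp add: compactin_PiE)
  then have "compact (PiE UNIV (\<lambda>i :: nat. {-1..1 :: real}))"
    by (simp add: euclidean_product_topology)
  moreover have "disc_set k \<subseteq> PiE UNIV (\<lambda>i :: nat. {-1..1 :: real})"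
  proof
    fix x assume x: "x \<in> disc_set k"
    have "\<bar>x i\<bar> \<le> 1" for i
      using x abs_le_vnorm[of i k x] by (cases "i < k") (auto simp: disc_set_def vspace_def)
    then have "-1 \<le> x i \<and> x i \<le> 1" for i
      by (simp add: abs_le_iff minus_le_iff)
    then show "x \<in> PiE UNIV (\<lambda>i :: nat. {-1..1 :: real})"
      by (simp add: PiE_iff)
  qed
  moreover have "closed (disc_set k)"
    unfolding disc_set_def Collect_conj_eq
    using closed_vspace by (intro closed_Int closed_Collect_le continuous_intros) auto
  ultimately show ?thesis
    using closed_Int_compact by (metis inf.absorb_iff1)
qed

lemma compact_space_disc: "compact_space (disc k)"
  by (simp add: disc_eq compact_space_subtopology compact_disc_set)

text \<open>Every point is the limit of its own multiples by \<open>t < 1\<close>. This is what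
  identifies the closure of a cell with the image of the closed disc.\<close>

lemma disc_set_subset_closure: "disc_set k \<subseteq> closure {x \<in> vspace k. vnorm k x < 1}"
proof
  fix x assume x: "x \<in> disc_set k"
  let ?g = "\<lambda>t i. t * x i" and ?T = "closure {x \<in> vspace k. vnorm k x < 1}"
  have "?g ` closure {0..<1} \<subseteq> ?T"
  proof (rule image_closure_subset)
    show "?g ` {0..<1} \<subseteq> ?T"
    proof
      fix z assume "z \<in> ?g ` {0..<1}"
      then obtain t where t: "z = ?g t" "0 \<le> t" "t < 1" by auto
      have "t * vnorm k x \<le> t * 1"
        using x t by (intro mult_left_mono) (auto simp: disc_set_def)
      then have "z \<in> {x \<in> vspace k. vnorm k x < 1}"
        using x t by (auto simp: disc_set_def vspace_scale vnorm_scale)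
      then show "z \<in> ?T"
        by (rule set_mp[OF closure_subset])
    qed
  qed (auto intro!: continuous_intros)
  then have "?g 1 \<in> ?T"
    by (rule subsetD) (rule imageI, simp)
  then show "x \<in> ?T" by simp
qed

lemma path_connected_space_disc: "path_connected_space (disc k)"
proof -
  have "path_component_of (disc k) (\<lambda>i. 0) x" if "x \<in> disc_set k" for x
    unfolding path_component_of_def
  proof (intro exI conjI)
    show "pathin (disc k) (\<lambda>t i. t * x i)"
      using that by (auto simp: pathin_def disc_eq intro!: continuous_intros disc_set_scale)
  qed auto
  then show ?thesis
    unfolding path_connected_space_iff_path_component
    by (metis path_component_of_sym path_component_of_trans topspace_disc)
qed

lemma prod_topology_disc:
  "prod_topology (top_of_set {0..1::real}) (disc k) = top_of_set ({0..1} \<times> disc_set k)"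
  by (simp add: disc_eq)

text \<open>The retraction of the cylinder \<open>{0..1} \<times> disc\<close> onto its bottom and mantle,
  by central projection from the point over the centre at height 2.\<close>

definition cyl_scale :: "nat \<Rightarrow> real \<Rightarrow> (nat \<Rightarrow> real) \<Rightarrow> real" where
  "cyl_scale k t x = max (vnorm k x) ((2 - t) / 2)"

text \<open>The ray from the projection centre through \<open>(t, x)\<close> consists of the points
  at height \<open>2 - (2 - t) / s\<close> over \<open>x / s\<close>. It meets the bottom at
  \<open>s = (2 - t) / 2\<close> and the mantle at \<open>s = vnorm k x\<close>; as \<open>s\<close>
  decreases from 1, the larger of the two is where it leaves the cylinder.\<close>

definition cyl_pt :: "nat \<Rightarrow> real \<Rightarrow> (nat \<Rightarrow> real) \<Rightarrow> nat \<Rightarrow> real" where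
  "cyl_pt k t x = (\<lambda>i. inverse (cyl_scale k t x) * x i)"

definition cyl_time :: "nat \<Rightarrow> real \<Rightarrow> (nat \<Rightarrow> real) \<Rightarrow> real" where
  "cyl_time k t x = 2 - (2 - t) / cyl_scale k t x"

lemma cyl_scale_pos: "t \<le> 1 \<Longrightarrow> cyl_scale k t x > 0"
  by (simp add: cyl_scale_def less_max_iff_disj)

lemma cyl_pt_in_disc:
  assumes "x \<in> disc_set k" "t \<le> 1"
  shows "cyl_pt k t x \<in> disc_set k"
proof -
  have "inverse (cyl_scale k t x) * vnorm k x \<le> 1"
    using cyl_scale_pos[OF assms(2), of k x] by (simp add: divide_simps cyl_scale_def)
  then show ?thesis
    using assms cyl_scale_pos[OF assms(2), of k x]
    by (auto simp: cyl_pt_def disc_set_def vspace_scale vnorm_scale)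
qed

lemma cyl_time_bounds:
  assumes "x \<in> disc_set k" "0 \<le> t" "t \<le> 1"
  shows "0 \<le> cyl_time k t x" "cyl_time k t x \<le> 1"
proof -
  have m: "cyl_scale k t x > 0" "cyl_scale k t x \<le> 1" "(2 - t) / 2 \<le> cyl_scale k t x"
    using assms cyl_scale_pos[of t k x] by (auto simp: cyl_scale_def disc_set_def)
  show "0 \<le> cyl_time k t x"
    using m by (simp add: cyl_time_def divide_simps)
  have "1 * cyl_scale k t x \<le> 1 * 1"
    using m by simp
  then have "cyl_scale k t x \<le> 2 - t"
    using assms by linarith
  then show "cyl_time k t x \<le> 1"
    using m by (simp add: cyl_time_def divide_simps)
qed

text \<open>Above the bottom the maximum in \<open>cyl_scale\<close> is attained by the norm, so the
  projected point has norm 1. This sends the later recursion into cells of lower dimension.\<close>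

lemma cyl_pt_boundary:
  assumes "x \<in> disc_set k" "t \<le> 1" "cyl_time k t x \<noteq> 0"
  shows "cyl_pt k t x \<in> disc_boundary k"
proof -
  have "cyl_scale k t x \<noteq> (2 - t) / 2"
  proof
    assume "cyl_scale k t x = (2 - t) / 2"
    then have "cyl_time k t x = 2 - (2 - t) / ((2 - t) / 2)"
      by (simp only: cyl_time_def)
    then show False
      using assms by (simp add: divide_simps)
  qed
  then have "cyl_scale k t x = vnorm k x"
    by (auto simp: cyl_scale_def max_def split: if_splits)
  then show ?thesis
    using assms cyl_scale_pos[OF assms(2), of k x]
    by (simp add: cyl_pt_def disc_boundary_eq disc_set_def vspace_scale vnorm_scale)
qed

lemma cyl_fixed:
  assumes "x \<in> disc_set k" "0 \<le> t" "t = 0 \<or> x \<in> disc_boundary k"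
  shows "cyl_pt k t x = x" "cyl_time k t x = t"
proof -
  have "cyl_scale k t x = 1"
    using assms by (auto simp: cyl_scale_def disc_set_def disc_boundary_eq)
  then show "cyl_pt k t x = x" "cyl_time k t x = t"
    by (auto simp: cyl_pt_def cyl_time_def)
qed

lemma continuous_on_cyl:
  "continuous_on ({0..1} \<times> disc_set k) (\<lambda>(t, x). (cyl_time k t x, cyl_pt k t x))"
proof -
  have "cyl_scale k (fst p) (snd p) \<noteq> 0" if "p \<in> {0..1} \<times> disc_set k" for p
    using that cyl_scale_pos[of "fst p" k "snd p"] by auto
  then show ?thesis
    unfolding split_beta cyl_time_def cyl_pt_def cyl_scale_def
    by (intro continuous_intros) auto
qed

text \<open>The maps on bottom and mantle composed with the retraction. On the common rim the bottom
  wins, and continuity requires \<open>b\<close> to agree with \<open>f\<close> there.\<close>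

definition cyl_ext ::
    "nat \<Rightarrow> ((nat \<Rightarrow> real) \<Rightarrow> 'b) \<Rightarrow> (real \<times> (nat \<Rightarrow> real) \<Rightarrow> 'b) \<Rightarrow> real \<times> (nat \<Rightarrow> real) \<Rightarrow> 'b" where
  "cyl_ext k f b = (\<lambda>(t, x). if cyl_time k t x = 0 then f (cyl_pt k t x)
                              else b (cyl_time k t x, cyl_pt k t x))"

lemma continuous_map_cyl_ext:
  assumes f: "continuous_map (disc k) Z f"
    and b: "continuous_map (top_of_set ({0..1} \<times> disc_boundary k)) Z b"
    and fb: "\<And>x. x \<in> disc_boundary k \<Longrightarrow> b (0, x) = f x"
  shows "continuous_map (top_of_set ({0..1} \<times> disc_set k)) Z (cyl_ext k f b)"
proof -
  let ?M = "{0..1} \<times> disc_boundary k" and ?B = "{0::real} \<times> disc_set k"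
  define g where "g = (\<lambda>(t, x). if t = 0 then f x else b (t, x))"
  have "continuous_map (top_of_set (?B \<union> ?M)) Z g"
  proof (rule continuous_map_paste)
    show "closedin (top_of_set (?B \<union> ?M)) ?B"
      by (auto intro!: closed_subset compact_imp_closed compact_Times compact_disc_set)
    have "closed {x. vnorm k x = 1}"
      by (intro closed_Collect_eq continuous_intros) auto
    moreover have "disc_boundary k = disc_set k \<inter> {x. vnorm k x = 1}"
      by (auto simp: disc_boundary_eq disc_set_def)
    ultimately have "compact (disc_boundary k)"
      using compact_Int_closed compact_disc_set by metis
    then show "closedin (top_of_set (?B \<union> ?M)) ?M"
      by (auto intro!: closed_subset compact_imp_closed compact_Times)
    have "continuous_map (top_of_set ?B) Z (\<lambda>p. f (snd p))"
      using f unfolding disc_eq by (rule continuous_map_compose_on) (auto intro!: continuous_on_snd continuous_on_id)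
    then have "continuous_map (top_of_set ?B) Z g"
      by (rule continuous_map_eq) (auto simp: g_def)
    then show "continuous_map (subtopology (top_of_set (?B \<union> ?M)) ?B) Z g"
      by (simp add: subtopology_subtopology Int_absorb1)
    have "continuous_map (top_of_set ?M) Z g"
      using b by (rule continuous_map_eq) (auto simp: g_def fb)
    then show "continuous_map (subtopology (top_of_set (?B \<union> ?M)) ?M) Z g"
      by (simp add: subtopology_subtopology Int_absorb1)
  qed auto
  then have "continuous_map (top_of_set ({0..1} \<times> disc_set k)) Z
      (\<lambda>p. g (case p of (t, x) \<Rightarrow> (cyl_time k t x, cyl_pt k t x)))"
  proof (rule continuous_map_compose_on[OF _ continuous_on_cyl])
    show "(\<lambda>(t, x). (cyl_time k t x, cyl_pt k t x)) ` ({0..1} \<times> disc_set k) \<subseteq> ?B \<union> ?M"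
    proof (rule image_subsetI)
      fix p :: "real \<times> (nat \<Rightarrow> real)" assume "p \<in> {0..1} \<times> disc_set k"
      then obtain t x where p: "p = (t, x)" "0 \<le> t" "t \<le> 1" "x \<in> disc_set k" by auto
      then show "(case p of (t, x) \<Rightarrow> (cyl_time k t x, cyl_pt k t x)) \<in> ?B \<union> ?M"
        using cyl_pt_in_disc[of x k t] cyl_time_bounds[of x k t] cyl_pt_boundary[of x k t] by auto
    qed
  qed
  then show ?thesis
    by (rule continuous_map_eq) (auto simp: g_def cyl_ext_def)
qed

section \<open>Maps on a disc with prescribed boundary values\<close>

text \<open>Two maps \<open>g\<close>, \<open>g0\<close> that agree on the boundary of the unit disc are glued to a map on the
  disc of radius 2, which is \<open>g\<close> on the unit disc and runs back along \<open>g0\<close> towards the centre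
  outside of it.  It is constant beyond radius 2, hence represents an element of a homotopy group,
  the difference of \<open>g\<close> and \<open>g0\<close>.\<close>

definition disc_glue :: "nat \<Rightarrow> ((nat \<Rightarrow> real) \<Rightarrow> 'b) \<Rightarrow> ((nat \<Rightarrow> real) \<Rightarrow> 'b) \<Rightarrow> (nat \<Rightarrow> real) \<Rightarrow> 'b" where
  "disc_glue k g g0 w =
     (if vnorm k w \<le> 1 then g w else g0 (\<lambda>i. (max 0 (2 - vnorm k w) / vnorm k w) * w i))"

lemma vnorm_radial:
  assumes "vnorm k x > 0"
  shows "vnorm k (\<lambda>i. (c / vnorm k x) * x i) = \<bar>c\<bar>"
  unfolding vnorm_scale using assms by simp

lemma disc_glue_far: "2 \<le> vnorm k w \<Longrightarrow> disc_glue k g g0 w = g0 (\<lambda>i. 0)"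
  by (simp add: disc_glue_def)

lemma continuous_map_disc_glue:
  assumes g: "continuous_map (disc k) Z g" and g0: "continuous_map (disc k) Z g0"
    and eq: "\<And>x. x \<in> disc_boundary k \<Longrightarrow> g x = g0 x"
  shows "continuous_map (top_of_set (vspace k)) Z (disc_glue k g g0)"
proof (rule continuous_map_paste)
  let ?B = "{w \<in> vspace k. 1 \<le> vnorm k w}"
  show "closedin (top_of_set (vspace k)) (disc_set k)"
    using compact_imp_closed[OF compact_disc_set] by (intro closed_subset) (auto simp: disc_set_def)
  show "closedin (top_of_set (vspace k)) ?B"
    unfolding Collect_conj_eq Collect_mem_eq
    by (auto intro!: closed_subset closed_Int closed_vspace closed_Collect_le continuous_intros)
  show "topspace (top_of_set (vspace k)) \<subseteq> disc_set k \<union> ?B"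
    by (auto simp: disc_set_def)
  have "continuous_map (top_of_set (disc_set k)) Z (disc_glue k g g0)"
    using g unfolding disc_eq
    by (rule continuous_map_eq) (auto simp: disc_glue_def disc_set_def)
  then show "continuous_map (subtopology (top_of_set (vspace k)) (disc_set k)) Z (disc_glue k g g0)"
    by (simp add: subtopology_subtopology Int_absorb1 disc_set_def)
  have "continuous_map (top_of_set ?B) Z
      (\<lambda>w. g0 (\<lambda>i. (max 0 (2 - vnorm k w) / vnorm k w) * w i))"
    using g0 unfolding disc_eq
  proof (rule continuous_map_compose_on)
    have "vnorm k w \<noteq> 0" if "w \<in> ?B" for w
      using that by auto
    then show "continuous_on ?B (\<lambda>w i. (max 0 (2 - vnorm k w) / vnorm k w) * w i)"
      by (intro continuous_intros) auto
    show "(\<lambda>w i. (max 0 (2 - vnorm k w) / vnorm k w) * w i) ` ?B \<subseteq> disc_set k"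
      by (auto simp: disc_set_def vspace_scale vnorm_radial simp del: times_divide_eq_left)
  qed
  then have "continuous_map (top_of_set ?B) Z (disc_glue k g g0)"
    by (rule continuous_map_eq) (auto simp: disc_glue_def eq disc_boundary_eq)
  then show "continuous_map (subtopology (top_of_set (vspace k)) ?B) Z (disc_glue k g g0)"
    by (simp add: subtopology_subtopology Int_absorb1)
qed

text \<open>The substitution \<open>4 * x - 2\<close> takes the unit cube to the cube
  \<open>[-2, 2]^k\<close>, which contains the disc of radius 2 and has its boundary where
  \<open>disc_glue\<close> is constant. Coordinates from \<open>k\<close> on,
  \<open>undefined\<close> on the cube, are reset to 0.\<close>

definition cube_glue :: "nat \<Rightarrow> ((nat \<Rightarrow> real) \<Rightarrow> 'b) \<Rightarrow> ((nat \<Rightarrow> real) \<Rightarrow> 'b) \<Rightarrow> (nat \<Rightarrow> real) \<Rightarrow> 'b" where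
  "cube_glue k g g0 x = disc_glue k g g0 (\<lambda>i. if i < k then 4 * x i - 2 else 0)"

lemma continuous_map_cube_coordinate:
  "i < k \<Longrightarrow> continuous_map (cube k) euclideanreal (\<lambda>x. x i)"
  unfolding cube_def
  using continuous_map_into_fulltopology[OF
      continuous_map_product_projection[of i "{..<k}" "\<lambda>i. top_of_set {0..1}"]] by simp

lemma continuous_map_cube_glue:
  assumes "continuous_map (disc k) Z g" "continuous_map (disc k) Z g0"
    and "\<And>x. x \<in> disc_boundary k \<Longrightarrow> g x = g0 x"
  shows "continuous_map (cube k) Z (cube_glue k g g0)"
proof -
  have "continuous_map (cube k) (Euclidean_space k) (\<lambda>x i. if i < k then 4 * x i - 2 else 0)"
    unfolding continuous_map_componentwise_Euclidean_space
    by (intro allI impI continuous_intros continuous_map_cube_coordinate) auto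
  then have "continuous_map (cube k) Z (disc_glue k g g0 \<circ> (\<lambda>x i. if i < k then 4 * x i - 2 else 0))"
    using continuous_map_disc_glue[OF assms]
    unfolding Euclidean_space_eq by (rule continuous_map_compose) auto
  then show ?thesis
    by (rule continuous_map_eq) (simp add: cube_glue_def)
qed

lemma cube_glue_boundary:
  assumes "x \<in> cube_boundary k"
  shows "cube_glue k g g0 x = g0 (\<lambda>i. 0)"
proof -
  let ?w = "\<lambda>i. if i < k then 4 * x i - 2 else 0"
  obtain i where "i < k" "x i = 0 \<or> x i = 1"
    using assms by (auto simp: cube_boundary_def)
  then have "2 \<le> vnorm k ?w"
    using abs_le_vnorm[of i k ?w] by auto
  then show ?thesis
    by (simp add: cube_glue_def disc_glue_far)
qed

text \<open>The inverse of the substitution in \<open>cube_glue\<close>, applied to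
  \<open>4 * k * v\<close> and clipped to the cube. The factor \<open>k\<close> is large enough for
  a vector of norm \<open>1 / 2\<close>, one of whose coordinates has absolute value at least
  \<open>1 / (2 * k)\<close>, to reach the boundary of the cube.\<close>

definition cube_clamp :: "nat \<Rightarrow> (nat \<Rightarrow> real) \<Rightarrow> nat \<Rightarrow> real" where
  "cube_clamp k v = (\<lambda>i\<in>{..<k}. max 0 (min 1 (real k * v i + 1 / 2)))"

lemma continuous_map_cube_clamp:
  "continuous_map (top_of_set (disc_set k)) (cube k) (cube_clamp k)"
  unfolding cube_def continuous_map_componentwise
proof (intro conjI ballI)
  fix i assume i: "i \<in> {..<k}"
  have "continuous_on (disc_set k) (\<lambda>v. v i)"
    by (rule continuous_on_product_then_coordinatewise) (rule continuous_on_id)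
  then have "continuous_on (disc_set k) (\<lambda>v. max 0 (min 1 (real k * v i + 1 / 2)))"
    by (intro continuous_intros)
  with i show "continuous_map (top_of_set (disc_set k)) (top_of_set {0..1}) (\<lambda>v. cube_clamp k v i)"
    by (simp add: cube_clamp_def)
qed (auto simp: cube_clamp_def)

text \<open>Clipping is harmless: it changes only vectors with a coordinate beyond 2 in absolute
  value, and before and after clipping these have norm at least 2, where the glued map is
  constant.\<close>

lemma cube_glue_clamp:
  assumes "v \<in> vspace k"
  shows "cube_glue k g g0 (cube_clamp k v) = disc_glue k g g0 (\<lambda>i. 4 * real k * v i)"
proof -
  let ?c = "\<lambda>i. if i < k then 4 * cube_clamp k v i - 2 else 0"
  have c: "?c i = max (-2) (min 2 (4 * real k * v i))" if "i < k" for i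
    using that by (simp add: cube_clamp_def max_def min_def)
  show ?thesis
  proof (cases "\<forall>i<k. \<bar>4 * real k * v i\<bar> \<le> 2")
    case True
    have "?c i = 4 * real k * v i" for i
    proof (cases "i < k")
      case i: True
      with True have "\<bar>4 * real k * v i\<bar> \<le> 2" by blast
      then have "max (-2) (min 2 (4 * real k * v i)) = 4 * real k * v i" by linarith
      with c[OF i] show ?thesis by simp
    qed (use assms in \<open>simp add: vspace_def\<close>)
    then have "?c = (\<lambda>i. 4 * real k * v i)" by blast
    then show ?thesis
      by (simp only: cube_glue_def)
  next
    case False
    then obtain i where i: "i < k" and big: "2 < \<bar>4 * real k * v i\<bar>"
      by (auto simp: not_le)
    have "\<bar>?c i\<bar> = 2"
      using c[OF i] big by linarith
    then have "2 \<le> vnorm k ?c"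
      using abs_le_vnorm[OF i, of ?c] by linarith
    moreover have "2 \<le> vnorm k (\<lambda>i. 4 * real k * v i)"
      using abs_le_vnorm[OF i, of "\<lambda>i. 4 * real k * v i"] big by linarith
    ultimately show ?thesis
      by (simp only: cube_glue_def disc_glue_far)
  qed
qed

text \<open>If all coordinates were below \<open>1 / (2 * k)\<close> in absolute value, the sum of
  these absolute values, which bounds the norm, would be below \<open>1 / 2\<close>.\<close>

lemma cube_clamp_boundary:
  assumes "0 < k" "1 / 2 \<le> vnorm k v"
  shows "cube_clamp k v \<in> cube_boundary k"
proof -
  have "\<exists>i<k. 1 / 2 \<le> real k * \<bar>v i\<bar>"
  proof (rule ccontr)
    assume "\<not> ?thesis"
    then have less: "\<bar>v i\<bar> < 1 / (2 * real k)" if "i < k" for i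
      using that assms(1) by (auto simp: field_simps not_le)
    have "vnorm k v \<le> (\<Sum>i<k. \<bar>v i\<bar>)"
      by (rule L2_set_le_sum_abs)
    also have "\<dots> < (\<Sum>i<k. 1 / (2 * real k))"
      using assms(1) less by (intro sum_strict_mono) auto
    also have "\<dots> = 1 / 2"
      using assms(1) by simp
    finally show False
      using assms(2) by linarith
  qed
  then obtain i where i: "i < k" "1 / 2 \<le> real k * \<bar>v i\<bar>" by blast
  have "real k * \<bar>v i\<bar> = \<bar>real k * v i\<bar>"
    by (simp add: abs_mult)
  then have "1 / 2 \<le> real k * v i \<or> real k * v i \<le> - (1 / 2)"
    using i(2) by linarith
  then have "cube_clamp k v i = 0 \<or> cube_clamp k v i = 1"
    using i(1) by (auto simp: cube_clamp_def)
  moreover have "cube_clamp k v \<in> topspace (cube k)"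
    by (auto simp: cube_def cube_clamp_def)
  ultimately show ?thesis
    using i(1) by (auto simp: cube_boundary_def)
qed

text \<open>The radial rescaling \<open>v \<mapsto> disc_scale k v * v\<close> runs out to radius 2, stays there, and
  comes back to radius 1 on the boundary.\<close>

definition disc_scale :: "nat \<Rightarrow> (nat \<Rightarrow> real) \<Rightarrow> real" where
  "disc_scale k v = min 2 (3 - 2 * vnorm k v) / max (vnorm k v) (1 / (2 * real k))"

text \<open>\<open>disc_scale\<close> has three regimes. Up to radius \<open>1 / (2 * k)\<close> it
  is the factor \<open>4 * k\<close> of \<open>cube_clamp\<close>; up to radius \<open>1 / 2\<close>
  both arguments have norm at least 2 and the glued map is constant; beyond, at norm
  \<open>N\<close>, the scaled point has norm \<open>3 - 2 * N\<close>, where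
  \<open>disc_glue\<close> evaluates \<open>g0\<close> at radius
  \<open>2 - (3 - 2 * N) = 2 * N - 1\<close>. So only the inner half depends on
  \<open>g\<close>.\<close>

lemma disc_glue_scale:
  assumes k: "0 < k" and v: "v \<in> disc_set k"
    and eq: "\<And>x. x \<in> disc_boundary k \<Longrightarrow> g x = g0 x"
  shows "disc_glue k g g0 (\<lambda>i. disc_scale k v * v i) =
    (if vnorm k v \<le> 1 / 2 then cube_glue k g g0 (cube_clamp k v)
     else g0 (\<lambda>i. ((2 * vnorm k v - 1) / vnorm k v) * v i))"
proof -
  define N where "N = vnorm k v"
  have N: "0 \<le> N" "N \<le> 1"
    using v by (auto simp: N_def disc_set_def vnorm_nonneg)
  have k1: "1 / (2 * real k) \<le> 1 / 2"
    using k by (simp add: field_simps)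
  have vs: "v \<in> vspace k"
    using v by (simp add: disc_set_def)
  show ?thesis
  proof (cases "N \<le> 1 / (2 * real k)")
    case True
    then have "disc_scale k v = 4 * real k"
      using order_trans[OF True k1] k by (simp add: disc_scale_def N_def[symmetric] max_def min_def)
    then show ?thesis
      using order_trans[OF True k1] by (simp add: cube_glue_clamp[OF vs] N_def[symmetric])
  next
    case False
    then have N0: "N > 0" "max N (1 / (2 * real k)) = N"
      using k by (auto intro: less_le_trans[of 0 "1 / (2 * real k)"])
    show ?thesis
    proof (cases "N \<le> 1 / 2")
      case half: True
      have "vnorm k (\<lambda>i. disc_scale k v * v i) = 2"
        using half N0 by (simp only: vnorm_scale disc_scale_def N_def[symmetric]) simp
      moreover have "2 \<le> vnorm k (\<lambda>i. 4 * real k * v i)"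
        using False k N by (simp only: vnorm_scale N_def[symmetric]) (simp add: field_simps)
      ultimately show ?thesis
        using half by (simp add: cube_glue_clamp[OF vs] N_def[symmetric] disc_glue_far)
    next
      case half: False
      have sc: "disc_scale k v = (3 - 2 * N) / N"
        using half N0 by (simp add: disc_scale_def N_def[symmetric])
      have nw: "vnorm k (\<lambda>i. disc_scale k v * v i) = 3 - 2 * N"
        using N N0 by (simp only: vnorm_scale sc N_def[symmetric]) simp
      show ?thesis
      \<comment> \<open>The rim is separate: at norm exactly 1 \<open>disc_glue\<close> takes its
        first branch and returns \<open>g\<close>, which is traded for \<open>g0\<close> by their
        agreement on the boundary.\<close>
      proof (cases "N = 1")
        case True
        then show ?thesis
          using sc nw eq[of v] vs by (simp add: disc_glue_def disc_boundary_eq N_def[symmetric])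
      next
        case False
        have "\<not> 3 - 2 * N \<le> 1"
          using False N by simp
        then have "disc_glue k g g0 (\<lambda>i. disc_scale k v * v i) =
            g0 (\<lambda>i. (max 0 (2 - (3 - 2 * N)) / (3 - 2 * N)) * (disc_scale k v * v i))"
          by (simp only: disc_glue_def nw if_False)
        also have "(\<lambda>i. (max 0 (2 - (3 - 2 * N)) / (3 - 2 * N)) * (disc_scale k v * v i)) =
            (\<lambda>i. (2 * N - 1) / N * v i)"
        proof
          fix i
          have "max 0 (2 - (3 - 2 * N)) = 2 * N - 1" "3 - 2 * N \<noteq> 0"
            using N half by auto
          moreover have "(c / M) * ((M / N) * a) = c / N * a" if "M \<noteq> 0" for a c M :: real
            using that by simp
          ultimately show "(max 0 (2 - (3 - 2 * N)) / (3 - 2 * N)) * (disc_scale k v * v i) =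
              (2 * N - 1) / N * v i"
            by (simp only: sc)
        qed
        finally show ?thesis
          using half by (simp only: N_def[symmetric] if_False)
      qed
    qed
  qed
qed

text \<open>\<open>homotopic_with\<close> prescribes the ends everywhere; here only values on the
  disc are compared, so formulas may differ outside it.\<close>

lemma homotopic_with_rel_disc_boundary:
  "homotopic_with (\<lambda>h. \<forall>x\<in>disc_boundary k. h x = c x) (disc k) Z p q \<longleftrightarrow>
    (\<exists>h. continuous_map (top_of_set ({0..1::real} \<times> disc_set k)) Z h \<and>
         (\<forall>x\<in>disc_set k. h (0, x) = p x) \<and> (\<forall>x\<in>disc_set k. h (1, x) = q x) \<and>
         (\<forall>t\<in>{0..1}. \<forall>x\<in>disc_boundary k. h (t, x) = c x))"
proof -
  have "(\<forall>x\<in>disc_boundary k. h x = c x) = (\<forall>x\<in>disc_boundary k. h' x = c x)"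
    if "\<And>x. x \<in> topspace (disc k) \<Longrightarrow> h x = h' x" for h h'
  proof -
    have "h x = h' x" if "x \<in> disc_boundary k" for x
      using \<open>\<And>x. x \<in> topspace (disc k) \<Longrightarrow> h x = h' x\<close> disc_boundary_subset that by auto
    then show ?thesis by simp
  qed
  then show ?thesis
    unfolding prod_topology_disc[symmetric] unfolding topspace_disc[symmetric] by (rule homotopic_with)
qed

text \<open>The scaling factor is moved linearly to 1. On the boundary it equals 1 throughout, and
  at the end \<open>disc_glue\<close> is evaluated inside the unit disc, where it is
  \<open>g\<close>.\<close>

lemma homotopic_disc_glue_scale:
  assumes k: "0 < k" and g: "continuous_map (disc k) Z g" and g0: "continuous_map (disc k) Z g0"
    and eq: "\<And>x. x \<in> disc_boundary k \<Longrightarrow> g x = g0 x"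
  shows "homotopic_with (\<lambda>h. \<forall>x\<in>disc_boundary k. h x = g0 x) (disc k) Z
    (\<lambda>v. disc_glue k g g0 (\<lambda>i. disc_scale k v * v i)) g"
proof -
  let ?h = "\<lambda>p. disc_glue k g g0 (\<lambda>i. ((1 - fst p) * disc_scale k (snd p) + fst p) * snd p i)"
  have glue: "continuous_map (top_of_set (vspace k)) Z (disc_glue k g g0)"
    by (rule continuous_map_disc_glue[OF g g0 eq])
  have snd: "continuous_on ({0..1} \<times> disc_set k) (snd :: real \<times> (nat \<Rightarrow> real) \<Rightarrow> nat \<Rightarrow> real)"
    by (intro continuous_on_snd continuous_on_id)
  have "continuous_on ({0..1} \<times> disc_set k) (\<lambda>p :: real \<times> (nat \<Rightarrow> real). disc_scale k (snd p))"
    unfolding disc_scale_def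
    by (intro continuous_intros snd) (use k in \<open>auto simp: max_def\<close>)
  then have "continuous_on ({0..1} \<times> disc_set k)
      (\<lambda>p i. ((1 - fst p) * disc_scale k (snd p) + fst p) * snd p i)"
    by (intro continuous_on_vscale snd continuous_intros)
  moreover have "(\<lambda>p i. ((1 - fst p) * disc_scale k (snd p) + fst p) * snd p i) ` ({0..1} \<times> disc_set k)
      \<subseteq> vspace k"
    by (auto simp: vspace_scale disc_set_def)
  ultimately have cont: "continuous_map (top_of_set ({0..1} \<times> disc_set k)) Z ?h"
    by (rule continuous_map_compose_on[OF glue])
  have scale1: "disc_scale k v = 1" if "v \<in> disc_boundary k" for v
    using that k by (auto simp: disc_scale_def disc_boundary_eq max_def field_simps)
  show ?thesis
    unfolding homotopic_with_rel_disc_boundary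
    by (rule exI[of _ ?h], intro conjI ballI cont)
      (auto simp: disc_glue_def scale1 disc_set_def disc_boundary_eq eq)
qed

text \<open>Up to radius \<open>1 / 2\<close> the given homotopy is run through
  \<open>cube_clamp\<close>; outside, the common part made from \<open>g0\<close> stays fixed. At
  radius \<open>1 / 2\<close> both formulas give the base point, because \<open>cube_clamp\<close>
  is on the boundary there and the outer formula evaluates \<open>g0\<close> at the centre. The
  rescaled glued maps at the two ends are traded for \<open>g\<close> and \<open>g'\<close> by
  \<open>homotopic_disc_glue_scale\<close>.\<close>

lemma homotopic_disc_if_homotopic_cube:
  assumes k: "0 < k" and g: "continuous_map (disc k) Z g" and g': "continuous_map (disc k) Z g'"
    and g0: "continuous_map (disc k) Z g0"
    and eq: "\<And>x. x \<in> disc_boundary k \<Longrightarrow> g x = g0 x" "\<And>x. x \<in> disc_boundary k \<Longrightarrow> g' x = g0 x"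
    and hom: "homotopic_with (\<lambda>h. h ` cube_boundary k \<subseteq> {g0 (\<lambda>i. 0)}) (cube k) Z
      (cube_glue k g g0) (cube_glue k g' g0)"
  shows "homotopic_with (\<lambda>h. \<forall>x\<in>disc_boundary k. h x = g0 x) (disc k) Z g g'"
proof -
  let ?P = "\<lambda>h. \<forall>x\<in>disc_boundary k. h x = g0 x"
  obtain L where L: "continuous_map (prod_topology (top_of_set {0..1}) (cube k)) Z L"
    and L0: "\<And>x. L (0, x) = cube_glue k g g0 x" and L1: "\<And>x. L (1, x) = cube_glue k g' g0 x"
    and Lb: "\<And>t x. t \<in> {0..1::real} \<Longrightarrow> x \<in> cube_boundary k \<Longrightarrow> L (t, x) = g0 (\<lambda>i. 0)"
    using hom unfolding homotopic_with_def by (auto simp: image_subset_iff)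
  let ?out = "\<lambda>v. g0 (\<lambda>i. ((2 * vnorm k v - 1) / vnorm k v) * v i)"
  define K where "K = (\<lambda>(t, v). if vnorm k v \<le> 1 / 2 then L (t, cube_clamp k v) else ?out v)"
  let ?A = "{0..1::real} \<times> (disc_set k \<inter> {v. vnorm k v \<le> 1 / 2})"
  let ?B = "{0..1::real} \<times> (disc_set k \<inter> {v. 1 / 2 \<le> vnorm k v})"
  have "continuous_map (top_of_set ({0..1} \<times> disc_set k)) Z K"
  proof (rule continuous_map_paste)
    have cl: "closed {v. vnorm k v \<le> 1 / 2}" "closed {v. 1 / 2 \<le> vnorm k v}"
      by (intro closed_Collect_le continuous_intros continuous_on_id)+
    then show "closedin (top_of_set ({0..1} \<times> disc_set k)) ?A"
      "closedin (top_of_set ({0..1} \<times> disc_set k)) ?B"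
      using compact_imp_closed[OF compact_disc_set]
      by (auto intro!: closed_subset closed_Times closed_Int closed_atLeastAtMost)
    have "continuous_map (top_of_set ?A) (prod_topology (top_of_set {0..1}) (cube k))
        (\<lambda>p. (fst p, cube_clamp k (snd p)))"
    proof (subst continuous_map_paired, intro conjI)
      show "continuous_map (top_of_set ?A) (top_of_set {0..1}) fst"
        by (auto intro!: continuous_on_fst continuous_on_id)
      show "continuous_map (top_of_set ?A) (cube k) (\<lambda>p. cube_clamp k (snd p))"
        by (rule continuous_map_compose_on[OF continuous_map_cube_clamp])
          (auto intro!: continuous_on_snd continuous_on_id)
    qed
    from continuous_map_compose[OF this L] have "continuous_map (top_of_set ?A) Z K"
      by (rule continuous_map_eq) (auto simp: K_def)
    then show "continuous_map (subtopology (top_of_set ({0..1} \<times> disc_set k)) ?A) Z K"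
      by (simp add: subtopology_subtopology Times_Int_Times Int_absorb1)
    have "continuous_map (top_of_set ?B) Z (\<lambda>p. ?out (snd p))"
    proof (rule continuous_map_compose_on[OF g0[unfolded disc_eq]])
      show "continuous_on ?B (\<lambda>p i. ((2 * vnorm k (snd p) - 1) / vnorm k (snd p)) * snd p i)"
        by (intro continuous_intros) auto
      show "(\<lambda>p i. ((2 * vnorm k (snd p) - 1) / vnorm k (snd p)) * snd p i) ` ?B \<subseteq> disc_set k"
        by (auto simp: disc_set_def vspace_scale vnorm_radial simp del: times_divide_eq_left)
    qed
    then have "continuous_map (top_of_set ?B) Z K"
      by (rule continuous_map_eq) (auto simp: K_def Lb cube_clamp_boundary[OF k] mult.commute[of "2 :: real"])
    then show "continuous_map (subtopology (top_of_set ({0..1} \<times> disc_set k)) ?B) Z K"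
      by (simp add: subtopology_subtopology Times_Int_Times Int_absorb1)
  qed auto
  moreover have "\<forall>t\<in>{0..1}. \<forall>x\<in>disc_boundary k. K (t, x) = g0 x"
    by (auto simp: K_def disc_boundary_eq)
  moreover have "K (0, x) = disc_glue k g g0 (\<lambda>i. disc_scale k x * x i)"
    "K (1, x) = disc_glue k g' g0 (\<lambda>i. disc_scale k x * x i)" if "x \<in> disc_set k" for x
    by (simp_all add: K_def L0 L1 disc_glue_scale[OF k that eq(1)] disc_glue_scale[OF k that eq(2)])
  ultimately have "homotopic_with ?P (disc k) Z (\<lambda>v. disc_glue k g g0 (\<lambda>i. disc_scale k v * v i))
      (\<lambda>v. disc_glue k g' g0 (\<lambda>i. disc_scale k v * v i))"
    unfolding homotopic_with_rel_disc_boundary by blast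
  then show ?thesis
    using homotopic_disc_glue_scale[OF k g g0 eq(1)] homotopic_disc_glue_scale[OF k g' g0 eq(2)]
    by (meson homotopic_with_symD homotopic_with_trans)
qed

section \<open>Counting maps on a disc by homotopy groups\<close>

lemma path_connected_space_cube: "path_connected_space (cube k)"
  by (simp add: cube_def path_connected_space_product_topology)

lemma homotopic_with_into_fulltopology:
  "homotopic_with P X (subtopology Y S) f g \<Longrightarrow> homotopic_with P X Y f g"
  unfolding homotopic_with_def by (meson continuous_map_into_fulltopology)

lemma homotopy_group_class_eqD:
  fixes k :: nat and Z :: "'b topology" and y :: 'b
  defines "R \<equiv> {(f, g). f \<in> cube_loops k Z y \<and> g \<in> cube_loops k Z y \<and>
    homotopic_with (\<lambda>h. h ` cube_boundary k \<subseteq> {y}) (cube k) Z f g}"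
  assumes "R `` {f} = R `` {g}" "g \<in> cube_loops k Z y"
  shows "homotopic_with (\<lambda>h. h ` cube_boundary k \<subseteq> {y}) (cube k) Z f g"
proof -
  have "(g, g) \<in> R"
    using assms(3) by (auto simp: R_def cube_loops_def)
  then have "(f, g) \<in> R"
    using assms(2) by blast
  then show ?thesis
    by (simp add: R_def)
qed

text \<open>In dimension 0 the disc is a point and the maps are told apart by path components.
  Otherwise one member of the family serves as reference \<open>g0\<close>, its value at the centre
  as base point, and \<open>j\<close> is sent to the difference class of \<open>\<phi> j\<close> and
  \<open>g0\<close>.\<close>

lemma disc_maps_representatives:
  fixes \<phi> :: "'j \<Rightarrow> (nat \<Rightarrow> real) \<Rightarrow> 'b" and \<mu> :: "'e rel"
  assumes \<mu>: "Cinfinite \<mu>" and Z: "homotopy_groups_le Z \<mu>"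
    and cont: "\<And>j. j \<in> J \<Longrightarrow> continuous_map (disc k) Z (\<phi> j)"
    and bd: "\<And>j x. j \<in> J \<Longrightarrow> x \<in> disc_boundary k \<Longrightarrow> \<phi> j x = c x"
  obtains J' where "J' \<subseteq> J" "|J'| \<le>o \<mu>"
    "\<And>j. j \<in> J \<Longrightarrow> \<exists>j'\<in>J'. homotopic_with (\<lambda>h. \<forall>x\<in>disc_boundary k. h x = c x) (disc k) Z (\<phi> j) (\<phi> j')"
proof -
  let ?rel = "\<lambda>f g. homotopic_with (\<lambda>h. \<forall>x\<in>disc_boundary k. h x = c x) (disc k) Z f g"
  let ?z = "\<lambda>i :: nat. 0 :: real"
  have in_Z: "\<phi> j ?z \<in> topspace Z" if "j \<in> J" for j
    using cont[OF that] zero_in_disc_set by (auto simp: continuous_map_def Pi_iff)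
  consider "J = {}" | "k = 0" | "0 < k" "J \<noteq> {}" by auto
  then show thesis
  proof cases
    case 1
    then show thesis
      using that[of "{}"] countable_card_of_ordLeq[OF \<mu>, of "{} :: 'j set"] by simp
  next
    case 2
    let ?\<tau> = "\<lambda>j. path_component_of_set Z (\<phi> j ?z)"
    have "?\<tau> ` J \<subseteq> path_components_of Z"
      using in_Z by (auto simp: path_components_of_def)
    then have "|?\<tau> ` J| \<le>o |path_components_of Z|"
      by (rule card_of_mono1)
    then have "|?\<tau> ` J| \<le>o \<mu>"
      using Z ordLeq_transitive by (auto simp: homotopy_groups_le_def)
    then obtain J' where J': "J' \<subseteq> J" "|J'| \<le>o \<mu>" "\<And>j. j \<in> J \<Longrightarrow> \<exists>j'\<in>J'. ?\<tau> j' = ?\<tau> j"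
      by (rule representatives_ordLeq) (rule that)
    have "?rel (\<phi> j) (\<phi> j')" if j: "j \<in> J" "j' \<in> J'" "?\<tau> j' = ?\<tau> j" for j j'
    proof -
      have "\<phi> j' ?z \<in> ?\<tau> j'"
        using j(2) J'(1) in_Z by (auto simp: path_component_of_refl)
      then have "path_component_of Z (\<phi> j ?z) (\<phi> j' ?z)"
        using j(3) by auto
      then obtain p where p: "pathin Z p" "p 0 = \<phi> j ?z" "p 1 = \<phi> j' ?z"
        by (auto simp: path_component_of_def)
      have d0: "disc_set k = {?z}" and b0: "disc_boundary k = {}"
        using 2 by (auto simp: disc_set_def disc_boundary_eq vspace_def)
      have "continuous_map (top_of_set ({0..1} \<times> disc_set k)) Z (\<lambda>q. p (fst q))"
        using p(1) unfolding pathin_def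
        by (rule continuous_map_compose_on) (auto intro!: continuous_on_fst continuous_on_id)
      then show ?thesis
        unfolding homotopic_with_rel_disc_boundary using p
        by (intro exI[of _ "\<lambda>q. p (fst q)"]) (simp add: d0 b0)
    qed
    then show thesis
      using that[OF J'(1,2)] J'(3) by blast
  next
    case 3
    then obtain j0 where j0: "j0 \<in> J" by auto
    define g0 where "g0 = \<phi> j0"
    define y where "y = g0 ?z"
    define C where "C = path_component_of_set Z y"
    have g0: "continuous_map (disc k) Z g0" and g0c: "\<And>x. x \<in> disc_boundary k \<Longrightarrow> g0 x = c x"
      using cont bd j0 by (auto simp: g0_def)
    have y: "y \<in> topspace Z"
      using in_Z j0 by (simp add: y_def g0_def)
    have C: "C \<in> path_components_of Z" "y \<in> C"
      using y by (auto simp: C_def path_components_of_def path_component_of_refl)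
    let ?glue = "\<lambda>j. cube_glue k (\<phi> j) g0"
    have eq: "\<phi> j x = g0 x" if "j \<in> J" "x \<in> disc_boundary k" for j x
      using that bd g0c by simp
    have loop: "?glue j \<in> cube_loops k (subtopology Z C) y" if j: "j \<in> J" for j
    proof -
      have cm: "continuous_map (cube k) Z (?glue j)"
        using continuous_map_cube_glue[OF cont[OF j] g0] eq[OF j] by blast
      have bdry: "?glue j x = y" if "x \<in> cube_boundary k" for x
        using cube_glue_boundary[OF that] by (simp add: y_def)
      \<comment> \<open>A corner of the cube, on the boundary since \<open>0 < k\<close>. It shows
        that the path connected image of the cube contains \<open>y\<close> and so lies in
        \<open>C\<close>.\<close>
      have x0: "(\<lambda>i\<in>{..<k}. 0) \<in> cube_boundary k"
        using 3(1) by (auto simp: cube_boundary_def cube_def)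
      have "path_connectedin Z (?glue j ` topspace (cube k))"
        using path_connectedin_continuous_map_image[OF cm] path_connected_space_cube
          path_connectedin_topspace by blast
      moreover have "y \<in> ?glue j ` topspace (cube k)"
        using bdry[OF x0] x0 by (auto simp: cube_boundary_def intro: rev_image_eqI)
      ultimately have "?glue j ` topspace (cube k) \<subseteq> C"
        unfolding C_def by (rule path_component_of_maximal)
      then show ?thesis
        using cm bdry by (auto simp: cube_loops_def continuous_map_in_subtopology)
    qed
    define R where "R = {(f, g). f \<in> cube_loops k (subtopology Z C) y \<and> g \<in> cube_loops k (subtopology Z C) y \<and>
      homotopic_with (\<lambda>h. h ` cube_boundary k \<subseteq> {y}) (cube k) (subtopology Z C) f g}"
    let ?\<tau> = "\<lambda>j. R `` {?glue j}"
    have "?\<tau> ` J \<subseteq> homotopy_group k (subtopology Z C) y"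
      using loop by (auto simp: homotopy_group_def R_def[symmetric] intro: quotientI)
    then have "|?\<tau> ` J| \<le>o |homotopy_group k (subtopology Z C) y|"
      by (rule card_of_mono1)
    moreover have "|homotopy_group k (subtopology Z C) y| \<le>o \<mu>"
      using Z C 3(1) by (auto simp: homotopy_groups_le_def)
    ultimately have "|?\<tau> ` J| \<le>o \<mu>"
      by (rule ordLeq_transitive)
    then obtain J' where J': "J' \<subseteq> J" "|J'| \<le>o \<mu>" "\<And>j. j \<in> J \<Longrightarrow> \<exists>j'\<in>J'. ?\<tau> j' = ?\<tau> j"
      by (rule representatives_ordLeq) (rule that)
    have "?rel (\<phi> j) (\<phi> j')" if j: "j \<in> J" "j' \<in> J'" "?\<tau> j' = ?\<tau> j" for j j'
    proof -
      have j': "j' \<in> J"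
        using j(2) J'(1) by blast
      have "homotopic_with (\<lambda>h. h ` cube_boundary k \<subseteq> {y}) (cube k) (subtopology Z C) (?glue j) (?glue j')"
        using homotopy_group_class_eqD[OF j(3)[symmetric, unfolded R_def] loop[OF j']] .
      then have "homotopic_with (\<lambda>h. h ` cube_boundary k \<subseteq> {g0 ?z}) (cube k) Z (?glue j) (?glue j')"
        unfolding y_def by (rule homotopic_with_into_fulltopology)
      then have "homotopic_with (\<lambda>h. \<forall>x\<in>disc_boundary k. h x = g0 x) (disc k) Z (\<phi> j) (\<phi> j')"
        using homotopic_disc_if_homotopic_cube[OF 3(1) cont[OF j(1)] cont[OF j'] g0]
          eq[OF j(1)] eq[OF j'] by blast
      then show ?thesis
        by (rule homotopic_with_mono) (simp add: g0c)
    qed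
    then show thesis
      using that[OF J'(1,2)] J'(3) by blast
  qed
qed

section \<open>Cell structure of CW complexes\<close>

lemma disc_set_eq: "disc_set k = {x \<in> vspace k. vnorm k x < 1} \<union> disc_boundary k"
  by (auto simp: disc_set_def disc_boundary_eq)

locale cw =
  fixes X :: "'a topology" and E :: "'a set set" and d :: "'a set \<Rightarrow> nat"
  assumes cw_complex: "cw_complex X E d"
begin

definition chi :: "'a set \<Rightarrow> (nat \<Rightarrow> real) \<Rightarrow> 'a" where
  "chi e = (SOME \<Phi>. characteristic_map X E d e \<Phi>)"

lemma Hausdorff: "Hausdorff_space X"
  using cw_complex by (simp add: cw_complex_def)

lemma Union_cells: "\<Union>E = topspace X"
  using cw_complex by (simp add: cw_complex_def)

lemma cells_disjoint: "e \<in> E \<Longrightarrow> c \<in> E \<Longrightarrow> x \<in> e \<Longrightarrow> x \<in> c \<Longrightarrow> e = c"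
  using cw_complex by (auto simp: cw_complex_def disjoint_def)

lemma cell_subset: "e \<in> E \<Longrightarrow> e \<subseteq> topspace X"
  using Union_cells by blast

lemma characteristic_map_chi:
  assumes "e \<in> E"
  shows "characteristic_map X E d e (chi e)"
proof -
  have "\<exists>\<Phi>. characteristic_map X E d e \<Phi>"
    using cw_complex assms by (auto simp: cw_complex_def)
  then show ?thesis
    unfolding chi_def by (rule someI_ex)
qed

lemma continuous_map_chi: "e \<in> E \<Longrightarrow> continuous_map (disc (d e)) X (chi e)"
  using characteristic_map_chi by (simp add: characteristic_map_def)

lemma chi_homeomorphic:
  assumes "e \<in> E"
  shows "chi e ` {x \<in> vspace (d e). vnorm (d e) x < 1} = e"
    "inj_on (chi e) {x \<in> vspace (d e). vnorm (d e) x < 1}"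
proof -
  have h: "homeomorphic_map (open_disc (d e)) (subtopology X e) (chi e)"
    using characteristic_map_chi[OF assms] by (simp add: characteristic_map_def)
  show "chi e ` {x \<in> vspace (d e). vnorm (d e) x < 1} = e"
    using homeomorphic_imp_surjective_map[OF h] cell_subset[OF assms]
    by (simp add: open_disc_eq Int_absorb1)
  show "inj_on (chi e) {x \<in> vspace (d e). vnorm (d e) x < 1}"
    using homeomorphic_imp_injective_map[OF h] by (simp add: open_disc_eq)
qed

lemma chi_boundary:
  assumes "e \<in> E"
  obtains F where "F \<subseteq> E" "finite F" "\<And>c. c \<in> F \<Longrightarrow> d c < d e" "chi e ` disc_boundary (d e) \<subseteq> \<Union>F"
  using characteristic_map_chi[OF assms] by (auto simp: characteristic_map_def)

lemma chi_disc: "e \<in> E \<Longrightarrow> chi e ` disc_set (d e) = e \<union> chi e ` disc_boundary (d e)"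
  using chi_homeomorphic(1) by (simp add: disc_set_eq image_Un)

lemma chi_in_topspace: "e \<in> E \<Longrightarrow> v \<in> disc_set (d e) \<Longrightarrow> chi e v \<in> topspace X"
  using continuous_map_chi by (auto simp: continuous_map_def Pi_iff)

lemma compactin_chi:
  assumes "e \<in> E" "closed B"
  shows "compactin X (chi e ` (B \<inter> disc_set (d e)))"
proof (rule image_compactin[OF _ continuous_map_chi[OF assms(1)]])
  show "compactin (disc (d e)) (B \<inter> disc_set (d e))"
    by (simp add: disc_eq compactin_subtopology closed_Int_compact compact_disc_set assms(2))
qed

text \<open>The image of the closed disc is compact, hence closed; conversely the open disc is dense
  in it and continuity carries closures into closures.\<close>

lemma closure_of_cell:
  assumes e: "e \<in> E"
  shows "X closure_of e = chi e ` disc_set (d e)"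
proof
  have "closedin X (chi e ` disc_set (d e))"
    using compactin_chi[OF e, of UNIV] Hausdorff compactin_imp_closedin by auto
  then show "X closure_of e \<subseteq> chi e ` disc_set (d e)"
    using chi_disc[OF e] by (intro closure_of_minimal) auto
  have "disc (d e) closure_of {x \<in> vspace (d e). vnorm (d e) x < 1} = disc_set (d e)"
    using disc_set_subset_closure[of "d e"]
    by (auto simp: disc_eq closure_of_subtopology disc_set_eq Int_absorb1)
  then show "chi e ` disc_set (d e) \<subseteq> X closure_of e"
    using continuous_map_image_closure_subset[OF continuous_map_chi[OF e],
        of "{x \<in> vspace (d e). vnorm (d e) x < 1}"] chi_homeomorphic(1)[OF e] by simp
qed

text \<open>Subcomplexes are handled as sets of cells: these can be counted inside
  \<open>Fpow E\<close> and shortened by one cell.\<close>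

definition closed_cells :: "'a set set \<Rightarrow> bool" where
  "closed_cells F \<longleftrightarrow> F \<subseteq> E \<and> (\<forall>e\<in>F. chi e ` disc_set (d e) \<subseteq> \<Union>F)"

lemma closed_cellsD: "closed_cells F \<Longrightarrow> e \<in> F \<Longrightarrow> chi e ` disc_set (d e) \<subseteq> \<Union>F"
  by (auto simp: closed_cells_def)

lemma closed_cells_insert:
  assumes "closed_cells F" "e \<in> E" "chi e ` disc_boundary (d e) \<subseteq> \<Union>F"
  shows "closed_cells (insert e F)"
proof -
  have "chi e ` disc_set (d e) \<subseteq> \<Union>(insert e F)"
    using assms(3) chi_disc[OF assms(2)] by auto
  moreover have "chi c ` disc_set (d c) \<subseteq> \<Union>(insert e F)" if "c \<in> F" for c
    using closed_cellsD[OF assms(1) that] by (rule order_trans) auto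
  ultimately show ?thesis
    using assms(1,2) unfolding closed_cells_def by blast
qed

lemma closed_cells_closure: "closed_cells F \<longleftrightarrow> F \<subseteq> E \<and> (\<forall>e\<in>F. X closure_of e \<subseteq> \<Union>F)"
  unfolding closed_cells_def using closure_of_cell by (metis subsetD)

lemma subcomplex_iff: "subcomplex X E A \<longleftrightarrow> (\<exists>F. closed_cells F \<and> A = \<Union>F)"
  unfolding subcomplex_def closed_cells_closure by auto

lemma closed_cells_Union:
  "(\<And>F. F \<in> \<F> \<Longrightarrow> closed_cells F) \<Longrightarrow> closed_cells (\<Union>\<F>)"
  unfolding closed_cells_def by blast

lemma closed_cells_subset_topspace: "closed_cells F \<Longrightarrow> \<Union>F \<subseteq> topspace X"
  using Union_cells by (auto simp: closed_cells_def)

lemma Union_closed_cells: "closed_cells F \<Longrightarrow> \<Union>F = (\<Union>e\<in>F. chi e ` disc_set (d e))"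
proof -
  assume F: "closed_cells F"
  have "e \<subseteq> chi e ` disc_set (d e)" "chi e ` disc_set (d e) \<subseteq> \<Union>F" if "e \<in> F" for e
    using F chi_disc[of e] that by (auto simp: closed_cells_def)
  then show ?thesis by blast
qed

text \<open>The finitely many lower cells that cover the attaching image need not form a subcomplex.
  Induction on dimension adds subcomplexes for their own boundaries; all cells stay below
  \<open>d e\<close>, as later inductions on dimension require.\<close>

lemma boundary_subcomplex:
  assumes "e \<in> E"
  obtains G where "finite G" "closed_cells G" "\<And>c. c \<in> G \<Longrightarrow> d c < d e"
    "chi e ` disc_boundary (d e) \<subseteq> \<Union>G"
  using assms
proof (induction "d e" arbitrary: e thesis rule: less_induct)
  case less
  obtain F where F: "F \<subseteq> E" "finite F" "\<And>c. c \<in> F \<Longrightarrow> d c < d e" "chi e ` disc_boundary (d e) \<subseteq> \<Union>F"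
    using chi_boundary[OF less.prems(2)] by metis
  have "\<exists>G. finite G \<and> closed_cells G \<and> (\<forall>c'\<in>G. d c' < d c) \<and> chi c ` disc_boundary (d c) \<subseteq> \<Union>G"
    if "c \<in> F" for c
    using less.hyps[OF F(3)[OF that]] F(1) that by (metis subsetD)
  then obtain G where G: "\<And>c. c \<in> F \<Longrightarrow> finite (G c) \<and> closed_cells (G c) \<and>
      (\<forall>c'\<in>G c. d c' < d c) \<and> chi c ` disc_boundary (d c) \<subseteq> \<Union>(G c)"
    by metis
  show ?case
  proof (rule less.prems(1))
    show "finite (F \<union> \<Union>(G ` F))"
      using F(2) G by auto
    have GF: "closed_cells (\<Union>(G ` F))"
      using G by (intro closed_cells_Union) auto
    show "closed_cells (F \<union> \<Union>(G ` F))"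
      unfolding closed_cells_def
    proof (intro conjI ballI)
      show "F \<union> \<Union>(G ` F) \<subseteq> E"
        using F(1) GF unfolding closed_cells_def by (intro Un_least) simp_all
      fix c assume "c \<in> F \<union> \<Union>(G ` F)"
      then show "chi c ` disc_set (d c) \<subseteq> \<Union>(F \<union> \<Union>(G ` F))"
      proof
        assume c: "c \<in> F"
        have "c \<in> E" "chi c ` disc_boundary (d c) \<subseteq> \<Union>(G c)"
          using G[OF c] c F(1) by auto
        then have "chi c ` disc_set (d c) \<subseteq> c \<union> \<Union>(G c)"
          by (simp only: chi_disc Un_mono subset_refl)
        then show ?thesis
          using c by blast
      next
        assume "c \<in> \<Union>(G ` F)"
        from closed_cellsD[OF GF this] show ?thesis
          by (rule order_trans) blast
      qed
    qed
    show "d c < d e" if "c \<in> F \<union> \<Union>(G ` F)" for c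
      using that F(3) G by (auto intro: less_trans)
    show "chi e ` disc_boundary (d e) \<subseteq> \<Union>(F \<union> \<Union>(G ` F))"
      using F(4) by auto
  qed
qed

lemma finite_subcomplex:
  assumes "finite F" "F \<subseteq> E"
  obtains G where "finite G" "closed_cells G" "F \<subseteq> G"
proof -
  have "\<exists>G. finite G \<and> closed_cells G \<and> e \<in> G" if "e \<in> F" for e
  proof -
    have e: "e \<in> E"
      using that assms(2) by blast
    obtain G where G: "finite G" "closed_cells G" "chi e ` disc_boundary (d e) \<subseteq> \<Union>G"
      using boundary_subcomplex[OF e] by metis
    then have "closed_cells (insert e G)"
      using e by (intro closed_cells_insert)
    then show ?thesis
      using G(1) by blast
  qed
  then obtain G where "\<And>e. e \<in> F \<Longrightarrow> finite (G e) \<and> closed_cells (G e) \<and> e \<in> G e"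
    by metis
  then show thesis
    using that[of "\<Union>(G ` F)"] assms(1) closed_cells_Union[of "G ` F"] by blast
qed

lemma closure_meets_finitely_many:
  assumes "e \<in> E"
  obtains F where "finite F" "F \<subseteq> E" "chi e ` disc_set (d e) \<subseteq> \<Union>F"
proof -
  obtain G where G: "finite G" "closed_cells G" "{e} \<subseteq> G"
    using finite_subcomplex[of "{e}"] assms by auto
  then show thesis
    using that[of G] by (auto simp: closed_cells_def)
qed

lemma closedin_cw:
  "C \<subseteq> topspace X \<Longrightarrow> (\<And>e. e \<in> E \<Longrightarrow> closedin X (C \<inter> chi e ` disc_set (d e))) \<Longrightarrow> closedin X C"
  using cw_complex closure_of_cell by (simp add: cw_complex_def)

text \<open>One point is picked from each open cell that meets \<open>K\<close>. A closed cell
  contains finitely many picked points, so by the weak topology every set of them is closed: they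
  form a closed discrete subset of a compact set, which is finite.\<close>

lemma compactin_subcomplex:
  assumes K: "compactin X K"
  obtains F where "finite F" "closed_cells F" "K \<subseteq> \<Union>F"
proof -
  define D where "D = {e \<in> E. e \<inter> K \<noteq> {}}"
  define p where "p = (\<lambda>e. SOME x. x \<in> e \<inter> K)"
  have p: "p e \<in> e" "p e \<in> K" "e \<in> E" if "e \<in> D" for e
    using that someI_ex[of "\<lambda>x. x \<in> e \<inter> K"] by (auto simp: D_def p_def)
  have KX: "K \<subseteq> topspace X"
    using K compactin_subset_topspace by blast
  have inj: "inj_on p D"
    using p cells_disjoint by (intro inj_onI) metis
  have cl: "closedin X S" if S: "S \<subseteq> p ` D" for S
  proof (rule closedin_cw)
    show "S \<subseteq> topspace X"
      using S p(2) KX by auto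
    fix e assume "e \<in> E"
    then obtain F where F: "finite F" "F \<subseteq> E" "chi e ` disc_set (d e) \<subseteq> \<Union>F"
      by (rule closure_meets_finitely_many)
    have "S \<inter> chi e ` disc_set (d e) \<subseteq> p ` F"
    proof
      fix x assume x: "x \<in> S \<inter> chi e ` disc_set (d e)"
      then obtain c where c: "c \<in> D" "x = p c" using S by auto
      obtain f where "f \<in> F" "x \<in> f" using x F(3) by auto
      then have "c = f"
        using c p[OF c(1)] F(2) cells_disjoint by blast
      then show "x \<in> p ` F"
        using c \<open>f \<in> F\<close> by blast
    qed
    then have "finite (S \<inter> chi e ` disc_set (d e))"
      using F(1) finite_surj by blast
    moreover have "S \<inter> chi e ` disc_set (d e) \<subseteq> topspace X"
      using \<open>S \<subseteq> topspace X\<close> by blast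
    ultimately show "closedin X (S \<inter> chi e ` disc_set (d e))"
      using Hausdorff by (intro closedin_Hausdorff_finite)
  qed
  have "finite (p ` D)"
  proof -
    have sub: "p ` D \<subseteq> topspace X"
      using p(2) KX by blast
    have "compactin X (p ` D)"
    proof (rule closed_compactin[OF K])
      show "p ` D \<subseteq> K"
        using p(2) by blast
    qed (simp add: cl)
    then have "compact_space (subtopology X (p ` D))"
      by (rule compact_space_subtopology)
    moreover have "subtopology X (p ` D) = discrete_topology (p ` D)"
    proof (rule discrete_topology_unique[THEN iffD2, symmetric], intro conjI ballI)
      show "topspace (subtopology X (p ` D)) = p ` D"
        using sub by auto
      fix x assume x: "x \<in> p ` D"
      have "closedin (subtopology X (p ` D)) (p ` D - {x})"
        using cl[of "p ` D - {x}"] by (auto intro: closedin_subset_topspace)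
      then have "openin (subtopology X (p ` D)) (p ` D - (p ` D - {x}))"
        using sub by (auto simp: closedin_def Int_absorb1)
      then show "openin (subtopology X (p ` D)) {x}"
        using x by (simp add: double_diff)
    qed
    ultimately show ?thesis
      by (simp add: compact_space_discrete_topology)
  qed
  then have "finite D"
    using inj finite_imageD by blast
  moreover have "D \<subseteq> E"
    by (auto simp: D_def)
  ultimately obtain F where "finite F" "closed_cells F" "D \<subseteq> F"
    by (rule finite_subcomplex)
  moreover have "K \<subseteq> \<Union>D"
    using KX Union_cells by (fastforce simp: D_def)
  ultimately show thesis
    using that by blast
qed

section \<open>Continuity tested on cells\<close>

lemma continuous_map_cw:
  assumes "\<And>e. e \<in> E \<Longrightarrow> continuous_map (disc (d e)) Y (\<lambda>v. f (chi e v))"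
  shows "continuous_map X Y f"
  unfolding continuous_map_closedin
proof (intro conjI allI impI)
  have dom: "\<exists>e\<in>E. \<exists>v\<in>disc_set (d e). x = chi e v" if "x \<in> topspace X" for x
    using that Union_cells chi_disc by blast
  show "f \<in> topspace X \<rightarrow> topspace Y"
  proof
    fix x assume "x \<in> topspace X"
    then obtain e v where "e \<in> E" "v \<in> disc_set (d e)" "x = chi e v"
      using dom by blast
    then show "f x \<in> topspace Y"
      using assms[of e] by (auto simp: continuous_map_def Pi_iff)
  qed
  fix C assume C: "closedin Y C"
  show "closedin X {x \<in> topspace X. f x \<in> C}"
  proof (rule closedin_cw)
    fix e assume e: "e \<in> E"
    have "closedin (disc (d e)) {v \<in> topspace (disc (d e)). f (chi e v) \<in> C}"
      using assms[OF e] C unfolding continuous_map_closedin by blast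
    then have "compactin (disc (d e)) {v \<in> disc_set (d e). f (chi e v) \<in> C}"
      using compact_space_disc closedin_compact_space by auto
    then have "compactin X (chi e ` {v \<in> disc_set (d e). f (chi e v) \<in> C})"
      using continuous_map_chi[OF e] by (rule image_compactin)
    moreover have "chi e ` {v \<in> disc_set (d e). f (chi e v) \<in> C} =
        {x \<in> topspace X. f x \<in> C} \<inter> chi e ` disc_set (d e)"
      using chi_in_topspace[OF e] by auto
    ultimately show "closedin X ({x \<in> topspace X. f x \<in> C} \<inter> chi e ` disc_set (d e))"
      using Hausdorff compactin_imp_closedin by metis
  qed auto
qed

lemma continuous_map_id_chi:
  assumes e: "e \<in> F" and F: "closed_cells F"
  shows "continuous_map (top_of_set ({0..1::real} \<times> disc_set (d e)))
    (prod_topology (top_of_set {0..1}) (subtopology X (\<Union>F))) (\<lambda>(t, v). (t, chi e v))"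
proof -
  have eE: "e \<in> E"
    using e F by (auto simp: closed_cells_def)
  have "continuous_map (top_of_set ({0..1::real} \<times> disc_set (d e))) X (\<lambda>p. chi e (snd p))"
    using continuous_map_chi[OF eE] unfolding disc_eq
    by (rule continuous_map_compose_on) (auto intro!: continuous_on_snd continuous_on_id)
  then have "continuous_map (top_of_set ({0..1::real} \<times> disc_set (d e)))
      (subtopology X (\<Union>F)) (\<lambda>p. chi e (snd p))"
    using closed_cellsD[OF F e] by (intro continuous_map_into_subtopology) auto
  moreover have "continuous_map (top_of_set ({0..1::real} \<times> disc_set (d e))) (top_of_set {0..1}) fst"
    by (auto intro!: continuous_on_fst continuous_on_id)
  ultimately show ?thesis
    unfolding split_beta continuous_map_paired by blast
qed

text \<open>With finitely many cells the cylinder is a finite union of images of compact cylinders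
  over discs, and maps from these into a Hausdorff space are closed. No statement about the weak
  topology of an infinite product is involved.\<close>

lemma continuous_map_cylinder:
  assumes fin: "finite F" and F: "closed_cells F"
    and cont: "\<And>e. e \<in> F \<Longrightarrow>
      continuous_map (top_of_set ({0..1::real} \<times> disc_set (d e))) Y (\<lambda>(t, v). h (t, chi e v))"
  shows "continuous_map (prod_topology (top_of_set {0..1}) (subtopology X (\<Union>F))) Y h"
  unfolding continuous_map_closedin
proof (intro conjI allI impI)
  let ?P = "prod_topology (top_of_set {0..1::real}) (subtopology X (\<Union>F))"
  let ?D = "\<lambda>e. {0..1::real} \<times> disc_set (d e)" and ?M = "\<lambda>e (t :: real, v). (t, chi e v)"
  have dom: "topspace ?P = (\<Union>e\<in>F. ?M e ` ?D e)"
    using closed_cells_subset_topspace[OF F] Union_closed_cells[OF F] by (fastforce simp: Int_absorb1)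
  show "h \<in> topspace ?P \<rightarrow> topspace Y"
    unfolding dom using cont by (fastforce simp: continuous_map_def Pi_iff)
  fix C assume C: "closedin Y C"
  have "closedin ?P (?M e ` {q \<in> ?D e. h (?M e q) \<in> C})" if e: "e \<in> F" for e
  proof -
    have "closedin (top_of_set (?D e)) {q \<in> topspace (top_of_set (?D e)). (case q of (t, v) \<Rightarrow> h (t, chi e v)) \<in> C}"
      using cont[OF e] C unfolding continuous_map_closedin by blast
    moreover have "{q \<in> topspace (top_of_set (?D e)). (case q of (t, v) \<Rightarrow> h (t, chi e v)) \<in> C} =
        {q \<in> ?D e. h (?M e q) \<in> C}"
      by auto
    ultimately have "closedin (top_of_set (?D e)) {q \<in> ?D e. h (?M e q) \<in> C}"
      by (simp only:)
    moreover have "compact_space (top_of_set (?D e))"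
      by (simp add: compact_space_subtopology compact_Times compact_disc_set)
    moreover have "Hausdorff_space ?P"
      using Hausdorff by (simp add: Hausdorff_space_prod_topology Hausdorff_space_subtopology)
    ultimately show ?thesis
      using continuous_map_id_chi[OF e F] T1_Spaces.continuous_imp_closed_map unfolding closed_map_def by blast
  qed
  moreover have "{p \<in> topspace ?P. h p \<in> C} = (\<Union>e\<in>F. ?M e ` {q \<in> ?D e. h (?M e q) \<in> C})"
    unfolding dom by blast
  ultimately show "closedin ?P {p \<in> topspace ?P. h p \<in> C}"
    using closedin_Union[of "(\<lambda>e. ?M e ` {q \<in> ?D e. h (?M e q) \<in> C}) ` F" ?P] fin
    by (simp only: finite_imageI) blast
qed

text \<open>A closed cell is path connected, so it lies in \<open>C\<close> or misses it; the weak
  topology then makes the complement of \<open>C\<close> closed.\<close>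

lemma openin_path_components:
  assumes C: "C \<in> path_components_of X"
  shows "openin X C"
proof -
  have sub: "C \<subseteq> topspace X"
    using C by (rule path_components_of_subset)
  have "closedin X (topspace X - C)"
  proof (rule closedin_cw)
    fix e assume e: "e \<in> E"
    have "path_connectedin X (chi e ` disc_set (d e))"
      using path_connectedin_continuous_map_image[OF continuous_map_chi[OF e]]
        path_connected_space_disc path_connectedin_topspace topspace_disc by metis
    then have "chi e ` disc_set (d e) \<subseteq> C \<or> disjnt C (chi e ` disc_set (d e))"
      using C path_components_of_maximal by blast
    then have "(topspace X - C) \<inter> chi e ` disc_set (d e) = {} \<or>
        (topspace X - C) \<inter> chi e ` disc_set (d e) = chi e ` disc_set (d e)"
      using chi_in_topspace[OF e] by (auto simp: disjnt_def)
    moreover have "closedin X (chi e ` disc_set (d e))"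
      using closure_of_cell[OF e] closedin_closure_of by metis
    ultimately show "closedin X ((topspace X - C) \<inter> chi e ` disc_set (d e))"
      by auto
  qed auto
  then show ?thesis
    using sub by (simp add: openin_closedin_eq)
qed

end

section \<open>Path components of mapping spaces\<close>

lemma topspace_compact_open_topology: "topspace (compact_open_topology X Y) = continuous_maps X Y"
proof -
  \<comment> \<open>The empty compact set imposes no condition, so the set of all maps is itself
    subbasic.\<close>
  have "continuous_maps X Y \<in> {{f \<in> continuous_maps X Y. f ` K \<subseteq> U} | K U. compactin X K \<and> openin Y U}"
    by (rule CollectI, rule exI[of _ "{}"], rule exI[of _ "{}"]) auto
  then show ?thesis
    unfolding compact_open_topology_def topology_generated_by_topspace by blast
qed

lemma topspace_nad_maps: "topspace (nad_maps n X A Y B) = {f \<in> continuous_maps X Y. preserves_nad n A B f}"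
  by (auto simp: nad_maps_def topspace_compact_open_topology)

lemma compact_open_topology_nhd:
  assumes "openin (compact_open_topology X Y) W" "f \<in> W"
  obtains S where "finite S" "\<And>K U. (K, U) \<in> S \<Longrightarrow> compactin X K \<and> openin Y U \<and> f ` K \<subseteq> U"
    "\<And>g. g \<in> continuous_maps X Y \<Longrightarrow> (\<And>K U. (K, U) \<in> S \<Longrightarrow> g ` K \<subseteq> U) \<Longrightarrow> g \<in> W"
proof -
  let ?S = "{{f \<in> continuous_maps X Y. f ` K \<subseteq> U} | K U. compactin X K \<and> openin Y U}"
  have "generate_topology_on ?S W"
    using assms(1) unfolding compact_open_topology_def by (rule openin_topology_generated_by)
  then have "\<exists>S. finite S \<and> (\<forall>(K, U)\<in>S. compactin X K \<and> openin Y U \<and> f ` K \<subseteq> U) \<and>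
      (\<forall>g\<in>continuous_maps X Y. (\<forall>(K, U)\<in>S. g ` K \<subseteq> U) \<longrightarrow> g \<in> W)"
    using assms(2)
  proof (induction rule: generate_topology_on.induct)
    case (Int a b)
    obtain S where S: "finite S" "\<forall>(K, U)\<in>S. compactin X K \<and> openin Y U \<and> f ` K \<subseteq> U"
        "\<forall>g\<in>continuous_maps X Y. (\<forall>(K, U)\<in>S. g ` K \<subseteq> U) \<longrightarrow> g \<in> a"
      using Int.IH(1) Int.prems by blast
    obtain T where T: "finite T" "\<forall>(K, U)\<in>T. compactin X K \<and> openin Y U \<and> f ` K \<subseteq> U"
        "\<forall>g\<in>continuous_maps X Y. (\<forall>(K, U)\<in>T. g ` K \<subseteq> U) \<longrightarrow> g \<in> b"
      using Int.IH(2) Int.prems by blast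
    show ?case
    proof (intro exI[of _ "S \<union> T"] conjI)
      show "\<forall>g\<in>continuous_maps X Y. (\<forall>(K, U)\<in>S \<union> T. g ` K \<subseteq> U) \<longrightarrow> g \<in> a \<inter> b"
      proof (intro ballI impI IntI)
        fix g assume g: "g \<in> continuous_maps X Y" "\<forall>(K, U)\<in>S \<union> T. g ` K \<subseteq> U"
        show "g \<in> a"
          using S(3)[rule_format, OF g(1)] g(2) by (simp only: ball_Un)
        show "g \<in> b"
          using T(3)[rule_format, OF g(1)] g(2) by (simp only: ball_Un)
      qed
      show "\<forall>(K, U)\<in>S \<union> T. compactin X K \<and> openin Y U \<and> f ` K \<subseteq> U"
        using S(2) T(2) by (simp only: ball_Un)
    qed (simp add: S(1) T(1))
  next
    case (UN \<K>)
    then obtain k where k: "k \<in> \<K>" "f \<in> k" by auto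
    show ?case
    proof -
      obtain S where S: "finite S" "\<forall>(K, U)\<in>S. compactin X K \<and> openin Y U \<and> f ` K \<subseteq> U"
          "\<forall>g\<in>continuous_maps X Y. (\<forall>(K, U)\<in>S. g ` K \<subseteq> U) \<longrightarrow> g \<in> k"
        using UN.IH[OF k] by (elim exE conjE)
      have "\<forall>g\<in>continuous_maps X Y. (\<forall>(K, U)\<in>S. g ` K \<subseteq> U) \<longrightarrow> g \<in> \<Union>\<K>"
        using S(3) k(1) by (meson UnionI)
      with S(1,2) show ?thesis
        by (intro exI[of _ S] conjI)
    qed
  next
    case (Basis s)
    then obtain K U where KU: "s = {f \<in> continuous_maps X Y. f ` K \<subseteq> U}" "compactin X K" "openin Y U"
      by auto
    show ?case
      by (rule exI[of _ "{(K, U)}"]) (use KU Basis.prems in auto)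
  qed simp
  then show thesis
    using that by (metis (no_types, lifting) case_prodD case_prodI2)
qed

text \<open>The component of \<open>z\<close> is the preimage under the equivalence \<open>f\<close>
  of the component of \<open>f z\<close>: the homotopy from \<open>g \<circ> f\<close> to
  \<open>id\<close> joins each \<open>x\<close> to \<open>g (f x)\<close>, so \<open>f\<close> also
  reflects being joined by a path.\<close>

lemma openin_path_components_of_has_cw_type:
  assumes Z: "has_cw_type TYPE('w) Z" and C: "C \<in> path_components_of Z"
  shows "openin Z C"
proof -
  obtain V :: "'w topology" and E d where V: "cw_complex V E d" and "Z homotopy_equivalent_space V"
    using Z by (auto simp: has_cw_type_def)
  then obtain f g where f: "continuous_map Z V f" and g: "continuous_map V Z g"
    and gf: "homotopic_with (\<lambda>x. True) Z Z (g \<circ> f) id"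
    by (auto simp: homotopy_equivalent_space_def)
  obtain z where z: "z \<in> topspace Z" "C = path_component_of_set Z z"
    using C by (auto simp: path_components_of_def)
  have fz: "f x \<in> topspace V" if "x \<in> topspace Z" for x
    using f that by (auto simp: continuous_map_def Pi_iff)
  have retract: "path_component_of Z (g (f x)) x" if "x \<in> topspace Z" for x
  proof -
    obtain h where h: "continuous_map (prod_topology (top_of_set {0..1::real}) Z) Z h"
      "\<And>x. h (0, x) = (g \<circ> f) x" "\<And>x. h (1, x) = id x"
      using gf by (auto simp: homotopic_with_def)
    have "continuous_map (top_of_set {0..1::real}) (prod_topology (top_of_set {0..1}) Z) (\<lambda>t. (t, x))"
      using that by (auto simp: continuous_map_paired)
    from continuous_map_compose[OF this h(1)] show ?thesis
      unfolding path_component_of_def pathin_def using h(2,3)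
      by (intro exI[of _ "h \<circ> (\<lambda>t. (t, x))"]) simp
  qed
  have iff: "path_component_of Z z x \<longleftrightarrow> path_component_of V (f z) (f x)" if x: "x \<in> topspace Z" for x
  proof
    assume "path_component_of Z z x"
    then show "path_component_of V (f z) (f x)"
      unfolding path_component_of using path_connectedin_continuous_map_image[OF f] by blast
  next
    assume "path_component_of V (f z) (f x)"
    then have "path_component_of Z (g (f z)) (g (f x))"
      unfolding path_component_of using path_connectedin_continuous_map_image[OF g] by blast
    then show "path_component_of Z z x"
      using retract[OF z(1)] retract[OF x] path_component_of_sym path_component_of_trans by metis
  qed
  have "openin V (path_component_of_set V (f z))"
    using cw.openin_path_components[OF cw.intro[OF V]] fz[OF z(1)]
    by (simp add: path_component_in_path_components_of)
  then have "openin Z {x \<in> topspace Z. f x \<in> path_component_of_set V (f z)}"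
    using f by (rule openin_continuous_map_preimage[rotated])
  moreover have "{x \<in> topspace Z. f x \<in> path_component_of_set V (f z)} = C"
    using iff path_component_in_topspace unfolding z(2) by fastforce
  ultimately show ?thesis by simp
qed

lemma path_component_nad_maps_nhd:
  assumes "has_cw_type TYPE('w) (nad_maps n X A Y B)"
    and C: "C \<in> path_components_of (nad_maps n X A Y B)" and f: "f \<in> C"
  obtains S where "finite S" "\<And>K U. (K, U) \<in> S \<Longrightarrow> compactin X K \<and> openin Y U \<and> f ` K \<subseteq> U"
    "\<And>g. g \<in> topspace (nad_maps n X A Y B) \<Longrightarrow> (\<And>K U. (K, U) \<in> S \<Longrightarrow> g ` K \<subseteq> U) \<Longrightarrow> g \<in> C"
proof -
  have "openin (nad_maps n X A Y B) C"
    using openin_path_components_of_has_cw_type[OF assms(1) C] .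
  then obtain W where W: "openin (compact_open_topology X Y) W" "C = W \<inter> {f. preserves_nad n A B f}"
    by (auto simp: nad_maps_def openin_subtopology)
  then have "f \<in> W"
    using f by simp
  then obtain S where S: "finite S" "\<And>K U. (K, U) \<in> S \<Longrightarrow> compactin X K \<and> openin Y U \<and> f ` K \<subseteq> U"
    "\<And>g. g \<in> continuous_maps X Y \<Longrightarrow> (\<And>K U. (K, U) \<in> S \<Longrightarrow> g ` K \<subseteq> U) \<Longrightarrow> g \<in> W"
    using compact_open_topology_nhd[OF W(1)] by metis
  show thesis
    by (rule that[OF S(1,2)]) (use S(3) W(2) in \<open>auto simp: topspace_nad_maps\<close>)
qed

section \<open>Networks of CW complexes\<close>

text \<open>Each point of \<open>Q\<close> has a closed ball inside \<open>U\<close> and a basis set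
  inside the open ball; this leaves room for the closures, which \<open>net_set\<close> needs in
  order to be compact.\<close>

lemma compact_between_basis:
  fixes B :: "'m :: metric_space set set"
  assumes B: "topological_basis B" and Q: "compact Q" and U: "open U" "Q \<subseteq> U"
  obtains \<C> where "finite \<C>" "\<C> \<subseteq> B" "Q \<subseteq> \<Union>\<C>" "\<Union>(closure ` \<C>) \<subseteq> U"
proof -
  have "\<exists>b\<in>B. x \<in> b \<and> closure b \<subseteq> U" if x: "x \<in> Q" for x
  proof -
    obtain r where r: "r > 0" "cball x r \<subseteq> U"
      using U x by (meson open_contains_cball subsetD)
    obtain b where "b \<in> B" "x \<in> b" "b \<subseteq> ball x r"
      by (rule topological_basisE[OF B open_ball, of x x r]) (use r(1) in auto)
    moreover from this have "closure b \<subseteq> cball x r"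
      by (meson ball_subset_cball closed_cball closure_minimal order_trans)
    ultimately show ?thesis
      using r(2) by blast
  qed
  then obtain b where b: "\<And>x. x \<in> Q \<Longrightarrow> b x \<in> B \<and> x \<in> b x \<and> closure (b x) \<subseteq> U"
    by metis
  have "open (b x)" if "x \<in> Q" for x
    using b[OF that] topological_basis_open[OF B] by simp
  moreover have "Q \<subseteq> \<Union>(b ` Q)"
    using b by blast
  ultimately obtain D where D: "D \<subseteq> Q" "finite D" "Q \<subseteq> \<Union>(b ` D)"
    by (rule compactE_image[OF Q]) (assumption, rule that)
  show thesis
    by (rule that[of "b ` D"]) (use D b in auto)
qed

context cw
begin

text \<open>A countable complex need not have a countable basis, so compact sets are enclosed in
  finite unions of pieces of closed cells instead. Taking closures of the basis sets makes the
  pieces compact.\<close>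

definition net_set :: "('a set \<times> (nat \<Rightarrow> real) set) set \<Rightarrow> 'a set" where
  "net_set P = (\<Union>(e, b)\<in>P. chi e ` (closure b \<inter> disc_set (d e)))"

lemma compactin_net_set:
  assumes "finite P" "P \<subseteq> E \<times> B"
  shows "compactin X (net_set P)"
  unfolding net_set_def
proof (rule compactin_Union)
  show "finite ((\<lambda>(e, b). chi e ` (closure b \<inter> disc_set (d e))) ` P)"
    using assms(1) by simp
qed (use assms(2) compactin_chi in auto)

text \<open>\<open>Q\<close> lies in finitely many cells; in the disc of each of them the preimage
  of \<open>Q\<close> is compact and that of \<open>U\<close> open, so the squeeze between compact
  and open sets of a metric space applies.\<close>

lemma net_set_between:
  assumes B: "topological_basis B" and Q: "compactin X Q" and U: "openin X U" "Q \<subseteq> U"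
  obtains P where "finite P" "P \<subseteq> E \<times> B" "Q \<subseteq> net_set P" "net_set P \<subseteq> U"
proof -
  obtain F where F: "finite F" "closed_cells F" "Q \<subseteq> \<Union>F"
    using compactin_subcomplex[OF Q] .
  have "\<exists>\<C>. finite \<C> \<and> \<C> \<subseteq> B \<and> {v \<in> disc_set (d e). chi e v \<in> Q} \<subseteq> \<Union>\<C> \<and>
      chi e ` (\<Union>(closure ` \<C>) \<inter> disc_set (d e)) \<subseteq> U" if e: "e \<in> F" for e
  proof -
    have eE: "e \<in> E"
      using e F(2) by (auto simp: closed_cells_def)
    have "closedin (disc (d e)) {v \<in> topspace (disc (d e)). chi e v \<in> Q}"
      using continuous_map_chi[OF eE] compactin_imp_closedin[OF Hausdorff Q]
      by (rule closedin_continuous_map_preimage)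
    then have "compactin (disc (d e)) {v \<in> disc_set (d e). chi e v \<in> Q}"
      using closedin_compact_space[OF compact_space_disc] by simp
    then have cpt: "compact {v \<in> disc_set (d e). chi e v \<in> Q}"
      by (simp add: disc_eq compactin_subtopology)
    have "openin (disc (d e)) {v \<in> topspace (disc (d e)). chi e v \<in> U}"
      using continuous_map_chi[OF eE] U(1) by (rule openin_continuous_map_preimage)
    then obtain T where T: "open T" "{v \<in> disc_set (d e). chi e v \<in> U} = disc_set (d e) \<inter> T"
      by (auto simp: disc_eq openin_open)
    have "{v \<in> disc_set (d e). chi e v \<in> Q} \<subseteq> T"
      using T(2) U(2) by blast
    then obtain \<C> where "finite \<C>" "\<C> \<subseteq> B" "{v \<in> disc_set (d e). chi e v \<in> Q} \<subseteq> \<Union>\<C>"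
        "\<Union>(closure ` \<C>) \<subseteq> T"
      by (rule compact_between_basis[OF B cpt T(1)])
    then show ?thesis
      using T(2) by (intro exI[of _ \<C>]) blast
  qed
  then have "\<forall>e\<in>F. \<exists>\<C>. finite \<C> \<and> \<C> \<subseteq> B \<and> {v \<in> disc_set (d e). chi e v \<in> Q} \<subseteq> \<Union>\<C> \<and>
      chi e ` (\<Union>(closure ` \<C>) \<inter> disc_set (d e)) \<subseteq> U" ..
  from bchoice[OF this] obtain \<C> where "\<forall>e\<in>F. finite (\<C> e) \<and> \<C> e \<subseteq> B \<and>
      {v \<in> disc_set (d e). chi e v \<in> Q} \<subseteq> \<Union>(\<C> e) \<and> chi e ` (\<Union>(closure ` \<C> e) \<inter> disc_set (d e)) \<subseteq> U" ..
  then have C: "\<And>e. e \<in> F \<Longrightarrow> finite (\<C> e) \<and> \<C> e \<subseteq> B \<and>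
      {v \<in> disc_set (d e). chi e v \<in> Q} \<subseteq> \<Union>(\<C> e) \<and> chi e ` (\<Union>(closure ` \<C> e) \<inter> disc_set (d e)) \<subseteq> U"
    by (rule bspec)
  show thesis
  proof (rule that[of "Sigma F \<C>"])
    show "finite (Sigma F \<C>)"
      using F(1) C by auto
    show "Sigma F \<C> \<subseteq> E \<times> B"
    proof (rule subsetI, clarify)
      fix e b assume "e \<in> F" "b \<in> \<C> e"
      then show "e \<in> E \<and> b \<in> B"
        using C[of e] F(2) by (auto simp: closed_cells_def)
    qed
    show "net_set (Sigma F \<C>) \<subseteq> U"
    proof
      fix x assume "x \<in> net_set (Sigma F \<C>)"
      then obtain e b v where "e \<in> F" "b \<in> \<C> e" "v \<in> closure b" "v \<in> disc_set (d e)" "x = chi e v"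
        by (auto simp: net_set_def)
      then show "x \<in> U"
        using C[of e] by blast
    qed
    show "Q \<subseteq> net_set (Sigma F \<C>)"
    proof
      fix x assume x: "x \<in> Q"
      then obtain e v where e: "e \<in> F" "v \<in> disc_set (d e)" "x = chi e v"
        using F(3) Union_closed_cells[OF F(2)] by blast
      then obtain b where b: "b \<in> \<C> e" "v \<in> b"
        using C[OF e(1)] x by blast
      then have "x \<in> chi e ` (closure b \<inter> disc_set (d e))"
        using e closure_subset by blast
      then show "x \<in> net_set (Sigma F \<C>)"
        using e(1) b(1) by (auto simp: net_set_def)
    qed
  qed
qed

end

text \<open>Each condition that \<open>f\<close> maps \<open>K\<close> into \<open>U\<close> is
  replaced by one between network sets that holds for \<open>f\<close> and implies it. A finite set
  of such conditions names the component: if two components had the same set, the map chosen in one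
  would also lie in the other.\<close>

lemma card_path_components_countable_target:
  fixes \<kappa> :: "'c rel"
  assumes X: "cw_complex X E d" and Y: "cw_complex Y E' d'" "countable E'"
    and Z: "has_cw_type TYPE('w) (nad_maps n X A Y B)"
    and \<kappa>: "Cinfinite \<kappa>" "|E| \<le>o \<kappa>"
  shows "|path_components_of (nad_maps n X A Y B)| \<le>o \<kappa>"
proof -
  interpret X: cw X E d by (rule cw.intro) fact
  interpret Y: cw Y E' d' by (rule cw.intro) fact
  let ?Z = "nad_maps n X A Y B"
  obtain Q :: "(nat \<Rightarrow> real) set set" where Q: "countable Q" "topological_basis Q"
    using ex_countable_basis by blast
  let ?T = "Fpow (Fpow (E \<times> Q) \<times> Fpow (E' \<times> Q))"
  let ?good = "\<lambda>s g. \<forall>(P, P')\<in>s. g ` X.net_set P \<subseteq> Y.net_set P'"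
  have "\<exists>f s. f \<in> C \<and> s \<in> ?T \<and> ?good s f \<and> (\<forall>g\<in>topspace ?Z. ?good s g \<longrightarrow> g \<in> C)"
    if C: "C \<in> path_components_of ?Z" for C
  proof -
    obtain f where f: "f \<in> C"
      using nonempty_path_components_of[OF C] by blast
    then have fcont: "continuous_map X Y f"
      using path_components_of_subset[OF C] by (auto simp: topspace_nad_maps continuous_maps_def)
    obtain S where S: "finite S" "\<And>K U. (K, U) \<in> S \<Longrightarrow> compactin X K \<and> openin Y U \<and> f ` K \<subseteq> U"
      "\<And>g. g \<in> topspace ?Z \<Longrightarrow> (\<And>K U. (K, U) \<in> S \<Longrightarrow> g ` K \<subseteq> U) \<Longrightarrow> g \<in> C"
      using path_component_nad_maps_nhd[OF Z C f] by metis
    have "\<exists>P P'. P \<in> Fpow (E \<times> Q) \<and> P' \<in> Fpow (E' \<times> Q) \<and> K \<subseteq> X.net_set P \<and>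
        f ` X.net_set P \<subseteq> Y.net_set P' \<and> Y.net_set P' \<subseteq> U" if KU: "(K, U) \<in> S" for K U
    proof -
      have K: "compactin X K" "openin Y U" "f ` K \<subseteq> U"
        using S(2)[OF KU] by auto
      have "openin X {x \<in> topspace X. f x \<in> U}"
        using fcont K(2) by (rule openin_continuous_map_preimage)
      moreover have "K \<subseteq> {x \<in> topspace X. f x \<in> U}"
        using K compactin_subset_topspace by fastforce
      ultimately obtain P where P: "finite P" "P \<subseteq> E \<times> Q" "K \<subseteq> X.net_set P"
          "X.net_set P \<subseteq> {x \<in> topspace X. f x \<in> U}"
        by (rule X.net_set_between[OF Q(2) K(1)])
      \<comment> \<open>The enlarged set is compact, hence so is its image; this permits the second
        squeeze, in \<open>Y\<close>.\<close>
      have "compactin Y (f ` X.net_set P)"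
        using X.compactin_net_set[OF P(1,2)] fcont by (rule image_compactin)
      moreover have "f ` X.net_set P \<subseteq> U"
        using P(4) by blast
      ultimately obtain P' where "finite P'" "P' \<subseteq> E' \<times> Q" "f ` X.net_set P \<subseteq> Y.net_set P'"
          "Y.net_set P' \<subseteq> U"
        using Y.net_set_between[OF Q(2) _ K(2)] by metis
      then show ?thesis
        using P by (auto simp: Fpow_def)
    qed
    then obtain p p' where p: "\<And>K U. (K, U) \<in> S \<Longrightarrow> p K U \<in> Fpow (E \<times> Q) \<and> p' K U \<in> Fpow (E' \<times> Q) \<and>
        K \<subseteq> X.net_set (p K U) \<and> f ` X.net_set (p K U) \<subseteq> Y.net_set (p' K U) \<and> Y.net_set (p' K U) \<subseteq> U"
      by metis
    define s where "s = (\<lambda>(K, U). (p K U, p' K U)) ` S"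
    have "s \<in> ?T"
    proof -
      have "s \<subseteq> Fpow (E \<times> Q) \<times> Fpow (E' \<times> Q)"
        unfolding s_def using p by (intro image_subsetI) (simp only: split_beta mem_Times_iff fst_conv snd_conv prod.collapse)
      then show ?thesis
        using S(1) by (simp add: s_def Fpow_def)
    qed
    moreover have "?good s f"
      using p by (auto simp: s_def)
    moreover have "g \<in> C" if g: "g \<in> topspace ?Z" "?good s g" for g
    proof (rule S(3)[OF g(1)])
      fix K U assume KU: "(K, U) \<in> S"
      then have "g ` X.net_set (p K U) \<subseteq> Y.net_set (p' K U)"
        using g(2) by (force simp: s_def)
      then show "g ` K \<subseteq> U"
        using p[OF KU] by blast
    qed
    ultimately show ?thesis
      using f by blast
  qed
  then have "\<forall>C\<in>path_components_of ?Z. \<exists>q. fst q \<in> C \<and> snd q \<in> ?T \<and> ?good (snd q) (fst q) \<and>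
      (\<forall>g\<in>topspace ?Z. ?good (snd q) g \<longrightarrow> g \<in> C)"
    by simp
  from bchoice[OF this] obtain q where "\<forall>C\<in>path_components_of ?Z. fst (q C) \<in> C \<and> snd (q C) \<in> ?T \<and>
      ?good (snd (q C)) (fst (q C)) \<and> (\<forall>g\<in>topspace ?Z. ?good (snd (q C)) g \<longrightarrow> g \<in> C)" ..
  moreover define f s where "f = fst \<circ> q" and "s = snd \<circ> q"
  ultimately have fs: "f C \<in> C" "s C \<in> ?T" "?good (s C) (f C)"
      "g \<in> topspace ?Z \<Longrightarrow> ?good (s C) g \<Longrightarrow> g \<in> C" if "C \<in> path_components_of ?Z" for C g
    using that by simp_all
  show ?thesis
  proof (rule card_of_ordLeq_inj)
    show "inj_on s (path_components_of ?Z)"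
    proof (rule inj_onI)
      fix C D assume C: "C \<in> path_components_of ?Z" and D: "D \<in> path_components_of ?Z" and "s C = s D"
      have "f C \<in> topspace ?Z"
        using fs(1)[OF C] path_components_of_subset[OF C] by (rule subsetD[rotated])
      then have "f C \<in> D"
        using fs(3)[OF C] unfolding \<open>s C = s D\<close> by (rule fs(4)[OF D])
      then show "C = D"
        using fs(1)[OF C] path_components_of_overlap[OF C D] by blast
    qed
    show "s ` path_components_of ?Z \<subseteq> ?T"
      by (intro image_subsetI fs(2))
    have Q\<kappa>: "|Q| \<le>o \<kappa>" "|E'| \<le>o \<kappa>"
      using countable_card_of_ordLeq[OF \<kappa>(1)] Q(1) Y(2) by auto
    have inf: "\<not> finite (Field \<kappa>)" "Card_order \<kappa>"
      using \<kappa>(1) by (auto simp: cinfinite_def)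
    show "|?T| \<le>o \<kappa>"
      by (intro card_of_Fpow_ordLeq card_of_Times_ordLeq_infinite_Field \<kappa> Q\<kappa> inf)
  qed
qed

section \<open>Homotopy extension\<close>

context cw
begin

definition cell_of :: "'a \<Rightarrow> 'a set" where
  "cell_of p = (THE e. e \<in> E \<and> p \<in> e)"

definition psi :: "'a set \<Rightarrow> 'a \<Rightarrow> nat \<Rightarrow> real" where
  "psi e = inv_into {x \<in> vspace (d e). vnorm (d e) x < 1} (chi e)"

lemma cell_of_eq: "e \<in> E \<Longrightarrow> p \<in> e \<Longrightarrow> cell_of p = e"
  unfolding cell_of_def using cells_disjoint by (intro the_equality) auto

lemma psi_chi: "e \<in> E \<Longrightarrow> v \<in> vspace (d e) \<Longrightarrow> vnorm (d e) v < 1 \<Longrightarrow> psi e (chi e v) = v"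
  unfolding psi_def using chi_homeomorphic(2) by (intro inv_into_f_f) auto

lemma chi_in_cell: "e \<in> E \<Longrightarrow> v \<in> vspace (d e) \<Longrightarrow> vnorm (d e) v < 1 \<Longrightarrow> chi e v \<in> e"
  using chi_homeomorphic(1) by blast

lemma cell_point:
  assumes "e \<in> E" "p \<in> e"
  obtains v where "v \<in> vspace (d e)" "vnorm (d e) v < 1" "p = chi e v"
  using assms chi_homeomorphic(1)[OF assms(1)] by blast

lemma open_disc_subset: "v \<in> vspace k \<Longrightarrow> vnorm k v < 1 \<Longrightarrow> v \<in> disc_set k"
  by (simp add: disc_set_eq)

lemma chi_boundary_lower:
  assumes e: "e \<in> E" and v: "v \<in> disc_boundary (d e)"
  obtains c where "c \<in> E" "d c < d e" "chi e v \<in> c"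
proof -
  obtain F where F: "F \<subseteq> E" "\<And>c. c \<in> F \<Longrightarrow> d c < d e" "chi e ` disc_boundary (d e) \<subseteq> \<Union>F"
    using chi_boundary[OF e] by metis
  then have "chi e v \<in> \<Union>F"
    using v by blast
  then show thesis
    using that F(1,2) by blast
qed

lemma in_closed_cells:
  assumes "closed_cells F" "e \<in> E" "p \<in> e" "p \<in> \<Union>F"
  shows "e \<in> F"
proof -
  obtain c where "c \<in> F" "p \<in> c"
    using assms(4) by blast
  moreover then have "c = e"
    using assms cells_disjoint by (auto simp: closed_cells_def)
  ultimately show ?thesis by simp
qed

text \<open>A homotopy \<open>h\<close> on the subcomplex \<open>\<Union>F0\<close>, starting at the restriction of \<open>f\<close>, is extended
  cell by cell: inside a cell \<open>e\<close>, the retraction of the cylinder leads either to the bottom,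
  where \<open>f\<close> applies, or to the boundary of \<open>e\<close>, which lies in cells of lower dimension.
  The comparison of dimensions holds automatically if \<open>t'\<close> is nonzero; it serves termination.\<close>

function hext :: "'a set set \<Rightarrow> ('a \<Rightarrow> 'b) \<Rightarrow> (real \<times> 'a \<Rightarrow> 'b) \<Rightarrow> real \<Rightarrow> 'a \<Rightarrow> 'b" where
  "hext F0 f h t p =
    (if p \<in> \<Union>F0 then h (t, p)
     else let e = cell_of p; v = psi e p; t' = cyl_time (d e) t v; q = chi e (cyl_pt (d e) t v)
          in if t' = 0 \<or> \<not> d (cell_of q) < d e then f q else hext F0 f h t' q)"
  by pat_completeness auto
termination
  by (relation "Wellfounded.measure (\<lambda>(F0, f, h, t, p). d (cell_of p))") auto

declare hext.simps [simp del]

lemma hext_0: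
  assumes F0: "\<And>p. p \<in> \<Union>F0 \<Longrightarrow> h (0, p) = f p" and p: "p \<in> topspace X"
  shows "hext F0 f h 0 p = f p"
proof -
  obtain e where e: "e \<in> E" "p \<in> e"
    using p Union_cells by blast
  then obtain v where v: "v \<in> vspace (d e)" "vnorm (d e) v < 1" "p = chi e v"
    by (rule cell_point)
  then have "psi e p = v" "cyl_pt (d e) 0 v = v" "cyl_time (d e) 0 v = 0"
    using psi_chi[OF e(1)] cyl_fixed[OF open_disc_subset, of v "d e" 0] by auto
  then show ?thesis
    using F0[of p] cell_of_eq[OF e] unfolding v(3)
    by (subst hext.simps) (simp add: Let_def)
qed

text \<open>The defining equation concerns open cells; here it is extended to the closed disc, where
  the retraction fixes boundary points. A closed cell thus sees \<open>cyl_ext\<close> with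
  \<open>hext\<close> itself on the mantle.\<close>

lemma hext_chi:
  assumes F0: "closed_cells F0" "\<And>p. p \<in> \<Union>F0 \<Longrightarrow> h (0, p) = f p"
    and e: "e \<in> E" "e \<notin> F0" and v: "v \<in> disc_set (d e)" and t: "0 \<le> t" "t \<le> 1"
  shows "hext F0 f h t (chi e v) =
    cyl_ext (d e) (\<lambda>v. f (chi e v)) (\<lambda>(t, v). hext F0 f h t (chi e v)) (t, v)"
proof (cases "v \<in> disc_boundary (d e)")
  case True
  then have "cyl_pt (d e) t v = v" "cyl_time (d e) t v = t"
    using cyl_fixed[OF v t(1)] by auto
  moreover have "hext F0 f h 0 (chi e v) = f (chi e v)"
    using hext_0[of F0 h f, OF F0(2)] chi_in_topspace[OF e(1) v] by simp
  ultimately show ?thesis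
    by (auto simp: cyl_ext_def)
next
  case False
  then have w: "v \<in> vspace (d e)" "vnorm (d e) v < 1"
    using v by (auto simp: disc_set_eq)
  have in_e: "chi e v \<in> e"
    using chi_in_cell[OF e(1) w] .
  then have "chi e v \<notin> \<Union>F0"
    using in_closed_cells[OF F0(1) e(1)] e(2) by blast
  \<comment> \<open>Off the bottom the retraction lands on the boundary, hence in a cell of lower
    dimension, and the guard in \<open>hext\<close> lets the recursion proceed.\<close>
  moreover have "d (cell_of (chi e (cyl_pt (d e) t v))) < d e" if nz: "cyl_time (d e) t v \<noteq> 0"
  proof -
    obtain c where "c \<in> E" "d c < d e" "chi e (cyl_pt (d e) t v) \<in> c"
      using chi_boundary_lower[OF e(1) cyl_pt_boundary[OF v t(2) nz]] .
    then show ?thesis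
      by (simp add: cell_of_eq)
  qed
  ultimately show ?thesis
    by (subst hext.simps) (auto simp: cell_of_eq[OF e(1) in_e] psi_chi[OF e(1) w] Let_def cyl_ext_def)
qed

text \<open>Induction on dimension: the mantle values of a cell factor through a finite subcomplex
  of lower cells, over which cellwise continuity yields joint continuity; \<open>cyl_ext\<close>
  then fills the cylinder.\<close>

lemma continuous_map_hext_chi:
  assumes f: "continuous_map X Y f"
    and F0: "closed_cells F0" "\<And>p. p \<in> \<Union>F0 \<Longrightarrow> h (0, p) = f p"
    and h: "continuous_map (prod_topology (top_of_set {0..1}) (subtopology X (\<Union>F0))) Y h"
    and e: "e \<in> E"
  shows "continuous_map (top_of_set ({0..1} \<times> disc_set (d e))) Y (\<lambda>(t, v). hext F0 f h t (chi e v))"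
  using e
proof (induction "d e" arbitrary: e rule: less_induct)
  case (less e)
  show ?case
  proof (cases "e \<in> F0")
    case True
    have "continuous_map (top_of_set ({0..1} \<times> disc_set (d e))) Y (h \<circ> (\<lambda>(t, v). (t, chi e v)))"
      using continuous_map_id_chi[OF True F0(1)] h by (rule continuous_map_compose)
    then show ?thesis
    proof (rule continuous_map_eq)
      fix q assume "q \<in> topspace (top_of_set ({0..1::real} \<times> disc_set (d e)))"
      then obtain t v where q: "q = (t, v)" "v \<in> disc_set (d e)" by auto
      then have "chi e v \<in> \<Union>F0"
        using closed_cellsD[OF F0(1) True] by blast
      then show "(h \<circ> (\<lambda>(t, v). (t, chi e v))) q = (case q of (t, v) \<Rightarrow> hext F0 f h t (chi e v))"
        by (simp add: q(1) hext.simps)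
    qed
  next
    case False
    obtain G where G: "finite G" "closed_cells G" "\<And>c. c \<in> G \<Longrightarrow> d c < d e"
        "chi e ` disc_boundary (d e) \<subseteq> \<Union>G"
      using boundary_subcomplex[OF less.prems] by metis
    have "continuous_map (prod_topology (top_of_set {0..1}) (subtopology X (\<Union>G))) Y
        (\<lambda>(t, p). hext F0 f h t p)"
    proof (rule continuous_map_cylinder[OF G(1,2)])
      fix c assume c: "c \<in> G"
      then have "c \<in> E"
        using G(2) by (auto simp: closed_cells_def)
      from less.hyps[OF G(3)[OF c] this] show
        "continuous_map (top_of_set ({0..1} \<times> disc_set (d c))) Y
          (\<lambda>(t, v). case (t, chi c v) of (t, p) \<Rightarrow> hext F0 f h t p)"
        by simp
    qed
    moreover have "continuous_map (top_of_set ({0..1::real} \<times> disc_boundary (d e)))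
        (prod_topology (top_of_set {0..1}) (subtopology X (\<Union>G))) (\<lambda>q. (fst q, chi e (snd q)))"
      unfolding continuous_map_paired
    proof
      show "continuous_map (top_of_set ({0..1::real} \<times> disc_boundary (d e))) (top_of_set {0..1}) fst"
        by (auto intro!: continuous_on_fst continuous_on_id)
      have "continuous_map (top_of_set ({0..1::real} \<times> disc_boundary (d e))) X (\<lambda>q. chi e (snd q))"
        using continuous_map_chi[OF less.prems] unfolding disc_eq
        by (rule continuous_map_compose_on)
          (use disc_boundary_subset in \<open>auto intro!: continuous_on_snd continuous_on_id\<close>)
      then show "continuous_map (top_of_set ({0..1::real} \<times> disc_boundary (d e)))
          (subtopology X (\<Union>G)) (\<lambda>q. chi e (snd q))"
        using G(4) by (intro continuous_map_into_subtopology) auto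
    qed
    ultimately have "continuous_map (top_of_set ({0..1::real} \<times> disc_boundary (d e))) Y
        ((\<lambda>(t, p). hext F0 f h t p) \<circ> (\<lambda>q. (fst q, chi e (snd q))))"
      by (rule continuous_map_compose[rotated])
    then have b: "continuous_map (top_of_set ({0..1::real} \<times> disc_boundary (d e))) Y
        (\<lambda>(t, v). hext F0 f h t (chi e v))"
      by (rule continuous_map_eq) auto
    have fe: "continuous_map (disc (d e)) Y (\<lambda>v. f (chi e v))"
      using continuous_map_compose[OF continuous_map_chi[OF less.prems] f] by (simp add: o_def)
    have "continuous_map (top_of_set ({0..1} \<times> disc_set (d e))) Y
        (cyl_ext (d e) (\<lambda>v. f (chi e v)) (\<lambda>(t, v). hext F0 f h t (chi e v)))"
    proof (rule continuous_map_cyl_ext[OF fe b])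
      fix v assume "v \<in> disc_boundary (d e)"
      then have "chi e v \<in> topspace X"
        using chi_in_topspace[OF less.prems] disc_boundary_subset by blast
      then show "(case (0, v) of (t, v) \<Rightarrow> hext F0 f h t (chi e v)) = f (chi e v)"
        using hext_0[of F0 h f, OF F0(2)] by simp
    qed
    moreover have eqn: "hext F0 f h t (chi e v) =
        cyl_ext (d e) (\<lambda>v. f (chi e v)) (\<lambda>(t, v). hext F0 f h t (chi e v)) (t, v)"
      if "v \<in> disc_set (d e)" "0 \<le> t" "t \<le> 1" for t v
      using F0 less.prems False that by (rule hext_chi)
    ultimately show ?thesis
      by (elim continuous_map_eq) (auto simp: eqn)
  qed
qed

text \<open>Meant for \<open>F\<close> the cells of \<open>A i\<close> and \<open>S = B i\<close>.
  Each recursion step stays in the closed cell, hence in the subcomplex, so it ends at a value of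
  \<open>f\<close> or \<open>h\<close> over \<open>\<Union>F\<close>.\<close>

lemma hext_preserves:
  assumes F0: "closed_cells F0" "\<And>p. p \<in> \<Union>F0 \<Longrightarrow> h (0, p) = f p"
    and F: "closed_cells F" and f: "\<And>p. p \<in> \<Union>F \<Longrightarrow> f p \<in> S"
    and h: "\<And>t p. 0 \<le> t \<Longrightarrow> t \<le> 1 \<Longrightarrow> p \<in> \<Union>F \<Longrightarrow> p \<in> \<Union>F0 \<Longrightarrow> h (t, p) \<in> S"
    and e: "e \<in> F" and v: "v \<in> disc_set (d e)" and t: "0 \<le> t" "t \<le> 1"
  shows "hext F0 f h t (chi e v) \<in> S"
  using e v t
proof (induction "d e" arbitrary: e v t rule: less_induct)
  case (less e)
  have eE: "e \<in> E"
    using less.prems(1) F by (auto simp: closed_cells_def)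
  have inF: "chi e w \<in> \<Union>F" if "w \<in> disc_set (d e)" for w
    using closed_cellsD[OF F less.prems(1)] that by blast
  show ?case
  proof (cases "e \<in> F0")
    case True
    then have "chi e v \<in> \<Union>F0"
      using closed_cellsD[OF F0(1) True] less.prems(2) by blast
    then show ?thesis
      using h[OF less.prems(3,4) inF[OF less.prems(2)]] by (simp add: hext.simps)
  next
    case False
    let ?t = "cyl_time (d e) t v" and ?w = "cyl_pt (d e) t v"
    have t': "0 \<le> ?t" "?t \<le> 1"
      using cyl_time_bounds[OF less.prems(2-4)] .
    have w: "?w \<in> disc_set (d e)"
      using cyl_pt_in_disc[OF less.prems(2,4)] .
    have "hext F0 f h ?t (chi e ?w) \<in> S" if nz: "?t \<noteq> 0"
    proof -
      obtain c where c: "c \<in> E" "d c < d e" "chi e ?w \<in> c"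
        using chi_boundary_lower[OF eE cyl_pt_boundary[OF less.prems(2,4) nz]] .
      then have cF: "c \<in> F"
        using in_closed_cells[OF F] inF[OF w] by blast
      obtain u where u: "u \<in> vspace (d c)" "vnorm (d c) u < 1" "chi e ?w = chi c u"
        using cell_point[OF c(1,3)] .
      show ?thesis
        unfolding u(3) by (rule less.hyps[OF c(2) cF open_disc_subset[OF u(1,2)] t'])
    qed
    moreover have "hext F0 f h t (chi e v) =
        cyl_ext (d e) (\<lambda>v. f (chi e v)) (\<lambda>(t, v). hext F0 f h t (chi e v)) (t, v)"
      using F0 eE False less.prems(2-4) by (rule hext_chi)
    ultimately show ?thesis
      using f[OF inF[OF w]] by (simp add: cyl_ext_def)
  qed
qed

end

section \<open>Counting homotopy classes of maps of n-ads\<close>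

locale cw_maps = cw X E d for X :: "'a topology" and E d +
  fixes n :: nat and A :: "nat \<Rightarrow> 'a set" and Y :: "'b topology" and B :: "nat \<Rightarrow> 'b set"
  assumes subcomplexes: "\<And>i. i < n \<Longrightarrow> subcomplex X E (A i)"
begin

abbreviation maps :: "('a \<Rightarrow> 'b) topology" where
  "maps \<equiv> nad_maps n X A Y B"

definition homotopic_over :: "'a set set \<Rightarrow> ('a \<Rightarrow> 'b) \<Rightarrow> ('a \<Rightarrow> 'b) \<Rightarrow> bool" where
  "homotopic_over F f g \<longleftrightarrow>
     homotopic_with (preserves_nad n (\<lambda>i. A i \<inter> \<Union>F) B) (subtopology X (\<Union>F)) Y f g"

lemma subcomplexE:
  assumes "i < n"
  obtains F where "closed_cells F" "A i = \<Union>F"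
  using subcomplexes[OF assms] by (auto simp: subcomplex_iff)

text \<open>All points of an open cell lie in the same sets \<open>A i\<close>; this makes
  \<open>nad_target\<close> at the centre the right target for the whole cell.\<close>

lemma cell_subset_if_meets:
  assumes "i < n" "e \<in> E" "x \<in> e" "x \<in> A i"
  shows "chi e ` disc_set (d e) \<subseteq> A i"
proof -
  obtain F where F: "closed_cells F" "A i = \<Union>F"
    using subcomplexE[OF assms(1)] .
  then have "e \<in> F"
    using in_closed_cells[OF F(1) assms(2,3)] assms(4) by blast
  then show ?thesis
    using closed_cellsD[OF F(1)] F(2) by blast
qed

lemma homotopic_over_iff:
  assumes "closed_cells F"
  shows "homotopic_over F f g \<longleftrightarrow>
    (\<exists>h. continuous_map (prod_topology (top_of_set {0..1::real}) (subtopology X (\<Union>F))) Y h \<and>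
       (\<forall>x\<in>\<Union>F. h (0, x) = f x) \<and> (\<forall>x\<in>\<Union>F. h (1, x) = g x) \<and>
       (\<forall>t\<in>{0..1}. preserves_nad n (\<lambda>i. A i \<inter> \<Union>F) B (\<lambda>x. h (t, x))))"
proof -
  have top: "topspace (subtopology X (\<Union>F)) = \<Union>F"
    using closed_cells_subset_topspace[OF assms] by auto
  have "preserves_nad n (\<lambda>i. A i \<inter> \<Union>F) B h = preserves_nad n (\<lambda>i. A i \<inter> \<Union>F) B k"
    if "\<And>x. x \<in> topspace (subtopology X (\<Union>F)) \<Longrightarrow> h x = k x" for h k
  proof -
    have "h ` (A i \<inter> \<Union>F) = k ` (A i \<inter> \<Union>F)" for i
      by (rule image_cong[OF refl]) (use that top in auto)
    then show ?thesis
      by (simp only: preserves_nad_def)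
  qed
  then have "homotopic_over F f g \<longleftrightarrow>
    (\<exists>h. continuous_map (prod_topology (top_of_set {0..1::real}) (subtopology X (\<Union>F))) Y h \<and>
       (\<forall>x\<in>topspace (subtopology X (\<Union>F)). h (0, x) = f x) \<and>
       (\<forall>x\<in>topspace (subtopology X (\<Union>F)). h (1, x) = g x) \<and>
       (\<forall>t\<in>{0..1}. preserves_nad n (\<lambda>i. A i \<inter> \<Union>F) B (\<lambda>x. h (t, x))))"
    unfolding homotopic_over_def by (rule homotopic_with)
  then show ?thesis
    unfolding top .
qed

lemma homotopic_over_sym: "homotopic_over F f g \<Longrightarrow> homotopic_over F g f"
  unfolding homotopic_over_def by (rule homotopic_with_symD)

lemma homotopic_over_trans: "homotopic_over F f g \<Longrightarrow> homotopic_over F g h \<Longrightarrow> homotopic_over F f h"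
  unfolding homotopic_over_def by (rule homotopic_with_trans)

lemma mapsD:
  assumes "f \<in> topspace maps"
  shows "continuous_map X Y f" "f \<in> extensional (topspace X)" "\<And>i x. i < n \<Longrightarrow> x \<in> A i \<Longrightarrow> f x \<in> B i"
  using assms by (auto simp: topspace_nad_maps continuous_maps_def preserves_nad_def)

text \<open>A compact \<open>K\<close> lies in a finite subcomplex, where \<open>H\<close> is
  jointly continuous. The times at which \<open>K\<close> is not mapped into \<open>U\<close> form
  the projection of a closed set along the compact \<open>K\<close>, hence a closed set.\<close>

lemma homotopy_path_in_maps:
  assumes cell: "\<And>e. e \<in> E \<Longrightarrow>
      continuous_map (top_of_set ({0..1} \<times> disc_set (d e))) Y (\<lambda>(t, v). H t (chi e v))"
    and nad: "\<And>t i x. 0 \<le> t \<Longrightarrow> t \<le> 1 \<Longrightarrow> i < n \<Longrightarrow> x \<in> A i \<Longrightarrow> H t x \<in> B i"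
  shows "pathin maps (\<lambda>t. restrict (H t) (topspace X))"
proof -
  let ?p = "\<lambda>t. restrict (H t) (topspace X)" and ?I = "top_of_set {0..1::real}"
  have A: "A i \<subseteq> topspace X" if "i < n" for i
    using subcomplexE[OF that] closed_cells_subset_topspace by metis
  have cm: "?p t \<in> continuous_maps X Y" if t: "t \<in> {0..1}" for t
  proof -
    have "continuous_map X Y (H t)"
    proof (rule continuous_map_cw)
      fix e assume e: "e \<in> E"
      have "continuous_map (top_of_set (disc_set (d e))) Y
          (\<lambda>v. (case (t, v) of (t, v) \<Rightarrow> H t (chi e v)))"
        by (rule continuous_map_compose_on[OF cell[OF e]])
          (use t in \<open>auto intro!: continuous_on_Pair continuous_on_const continuous_on_id\<close>)
      then show "continuous_map (disc (d e)) Y (\<lambda>v. H t (chi e v))"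
        by (simp add: disc_eq)
    qed
    then have "continuous_map X Y (?p t)"
      by (rule continuous_map_eq) auto
    then show ?thesis
      by (simp add: continuous_maps_def)
  qed
  have "continuous_map ?I (compact_open_topology X Y) ?p"
    unfolding compact_open_topology_def
  proof (rule continuous_on_generated_topo)
    show "?p ` topspace ?I \<subseteq> \<Union>{{f \<in> continuous_maps X Y. f ` K \<subseteq> U} | K U. compactin X K \<and> openin Y U}"
      using cm topspace_compact_open_topology[of X Y]
      unfolding compact_open_topology_def topology_generated_by_topspace by auto
    fix W assume "W \<in> {{f \<in> continuous_maps X Y. f ` K \<subseteq> U} | K U. compactin X K \<and> openin Y U}"
    then obtain K U where W: "W = {f \<in> continuous_maps X Y. f ` K \<subseteq> U}"
      and K: "compactin X K" and U: "openin Y U" by auto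
    obtain F where F: "finite F" "closed_cells F" "K \<subseteq> \<Union>F"
      using compactin_subcomplex[OF K] .
    have FE: "F \<subseteq> E"
      using F(2) by (simp add: closed_cells_def)
    have KX: "K \<subseteq> topspace X"
      using K by (rule compactin_subset_topspace)
    let ?H = "\<lambda>(t, x). H t x" and ?P = "prod_topology ?I (subtopology X K)"
    have "continuous_map (prod_topology ?I (subtopology X (\<Union>F))) Y ?H"
      by (rule continuous_map_cylinder[OF F(1,2)]) (use cell FE in auto)
    moreover have "?P = subtopology (prod_topology ?I (subtopology X (\<Union>F))) (topspace ?I \<times> K)"
    proof -
      have "subtopology X K = subtopology (subtopology X (\<Union>F)) K"
        using F(3) by (simp add: subtopology_subtopology Int_absorb1)
      then show ?thesis
        using prod_topology_subtopology(2)[of ?I "subtopology X (\<Union>F)" K] by (simp only:)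
    qed
    ultimately have cH: "continuous_map ?P Y ?H"
      by (simp add: continuous_map_from_subtopology)
    have "closedin ?P {q \<in> topspace ?P. ?H q \<in> topspace Y - U}"
      using cH U by (intro closedin_continuous_map_preimage[OF cH]) auto
    moreover have "closed_map ?P ?I fst"
      using K by (intro Abstract_Topological_Spaces.closed_map_fst compact_space_subtopology)
    ultimately have "closedin ?I (fst ` {q \<in> topspace ?P. ?H q \<in> topspace Y - U})"
      by (simp only: closed_map_def)
    then have "openin ?I (topspace ?I - fst ` {q \<in> topspace ?P. ?H q \<in> topspace Y - U})"
      by (rule openin_diff[OF openin_topspace])
    moreover have "topspace ?I - fst ` {q \<in> topspace ?P. ?H q \<in> topspace Y - U} = ?p -` W \<inter> topspace ?I"
    proof (rule set_eqI)
      fix t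
      show "t \<in> topspace ?I - fst ` {q \<in> topspace ?P. ?H q \<in> topspace Y - U} \<longleftrightarrow> t \<in> ?p -` W \<inter> topspace ?I"
      proof (cases "t \<in> {0..1}")
        case True
        have "H t x \<in> topspace Y" if "x \<in> K" for x
        proof -
          have "(t, x) \<in> topspace ?P"
            using True that KX by auto
          then show ?thesis
            using cH by (auto simp: continuous_map_def Pi_iff)
        qed
        then have "t \<in> fst ` {q \<in> topspace ?P. ?H q \<in> topspace Y - U} \<longleftrightarrow> (\<exists>x\<in>K. H t x \<notin> U)"
          using True KX by (force simp: image_iff)
        moreover have "?p t \<in> W \<longleftrightarrow> (\<forall>x\<in>K. H t x \<in> U)"
          using cm[OF True] KX by (auto simp: W image_subset_iff)
        ultimately show ?thesis
          using True by simp
      qed auto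
    qed
    ultimately show "openin ?I (?p -` W \<inter> topspace ?I)"
      by (simp only:)
  qed
  moreover have "preserves_nad n A B (?p t)" if "t \<in> {0..1}" for t
    unfolding preserves_nad_def
  proof (intro allI impI image_subsetI)
    fix i x assume "i < n" "x \<in> A i"
    then show "?p t x \<in> B i"
      using A[of i] nad[of t i x] that by auto
  qed
  ultimately show ?thesis
    unfolding pathin_def nad_maps_def by (intro continuous_map_into_subtopology) auto
qed

text \<open>The conclusions serve different ends: the path shows that \<open>f'\<close> stays in the
  component of \<open>f\<close>, while the homotopies over finite subcomplexes enter the induction
  that counts homotopy classes. Both are read off the same \<open>hext\<close>.\<close>

lemma homotopy_extension:
  assumes F0: "closed_cells F0" and f: "f \<in> topspace maps" and hom: "homotopic_over F0 f g"
  obtains f' where "f' \<in> topspace maps" "\<And>x. x \<in> \<Union>F0 \<Longrightarrow> f' x = g x" "path_component_of maps f f'"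
    "\<And>F. finite F \<Longrightarrow> closed_cells F \<Longrightarrow> homotopic_over F f f'"
proof -
  obtain h where h: "continuous_map (prod_topology (top_of_set {0..1::real}) (subtopology X (\<Union>F0))) Y h"
    and h0: "\<And>x. x \<in> \<Union>F0 \<Longrightarrow> h (0, x) = f x" and h1: "\<And>x. x \<in> \<Union>F0 \<Longrightarrow> h (1, x) = g x"
    and hA: "\<And>t. t \<in> {0..1} \<Longrightarrow> preserves_nad n (\<lambda>i. A i \<inter> \<Union>F0) B (\<lambda>x. h (t, x))"
    using hom unfolding homotopic_over_iff[OF F0] by metis
  let ?H = "hext F0 f h"
  have cell: "continuous_map (top_of_set ({0..1} \<times> disc_set (d e))) Y (\<lambda>(t, v). ?H t (chi e v))"
    if "e \<in> E" for e
    using mapsD(1)[OF f] F0 h0 h that by (rule continuous_map_hext_chi)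
  have nad: "?H t x \<in> B i" if t: "0 \<le> t" "t \<le> 1" and i: "i < n" and x: "x \<in> A i" for t i x
  proof -
    obtain F where F: "closed_cells F" "A i = \<Union>F"
      using subcomplexE[OF i] .
    then obtain e where e: "e \<in> F" "x \<in> e"
      using x by blast
    then have "e \<in> E"
      using F(1) by (auto simp: closed_cells_def)
    then obtain v where v: "v \<in> vspace (d e)" "vnorm (d e) v < 1" "x = chi e v"
      using cell_point e(2) by metis
    show ?thesis
      unfolding v(3)
    proof (rule hext_preserves[of F0 h f F])
      show "f p \<in> B i" if "p \<in> \<Union>F" for p
        using mapsD(3)[OF f i] that F(2) by blast
      show "h (s, p) \<in> B i" if "0 \<le> s" "s \<le> 1" "p \<in> \<Union>F" "p \<in> \<Union>F0" for s p
        using hA[of s] that F(2) i by (auto simp: preserves_nad_def image_subset_iff)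
    qed (use F0 h0 F(1) e(1) open_disc_subset[OF v(1,2)] t in auto)
  qed
  define f' where "f' = restrict (?H 1) (topspace X)"
  have path: "pathin maps (\<lambda>t. restrict (?H t) (topspace X))"
    using cell nad by (rule homotopy_path_in_maps)
  have H0: "?H 0 x = f x" if "x \<in> topspace X" for x
    using h0 that by (rule hext_0)
  have "restrict (?H 0) (topspace X) = f"
  proof (rule extensionalityI[OF restrict_extensional mapsD(2)[OF f]])
    show "restrict (?H 0) (topspace X) x = f x" if "x \<in> topspace X" for x
      using H0[OF that] that by simp
  qed
  then have pc: "path_component_of maps f f'"
    using path by (auto simp: path_component_of_def f'_def)
  show thesis
  proof (rule that[OF _ _ pc])
    show "f' \<in> topspace maps"
      using path_component_in_topspace[OF pc] by simp
    show "f' x = g x" if "x \<in> \<Union>F0" for x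
      using that h1 closed_cells_subset_topspace[OF F0] by (auto simp: f'_def hext.simps)
    show "homotopic_over F f f'" if F: "finite F" "closed_cells F" for F
      unfolding homotopic_over_iff[OF F(2)]
    proof (intro exI[of _ "\<lambda>(t, x). ?H t x"] conjI ballI)
      have FE: "F \<subseteq> E"
        using F(2) by (simp add: closed_cells_def)
      show "continuous_map (prod_topology (top_of_set {0..1}) (subtopology X (\<Union>F))) Y (\<lambda>(t, x). ?H t x)"
        by (rule continuous_map_cylinder[OF F]) (use cell FE in auto)
      fix x assume "x \<in> \<Union>F"
      then have x: "x \<in> topspace X"
        using closed_cells_subset_topspace[OF F(2)] by blast
      show "(case (0, x) of (t, x) \<Rightarrow> ?H t x) = f x"
        using H0[OF x] by simp
      show "(case (1, x) of (t, x) \<Rightarrow> ?H t x) = f' x"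
        using x by (simp add: f'_def)
    next
      fix t :: real assume "t \<in> {0..1}"
      then show "preserves_nad n (\<lambda>i. A i \<inter> \<Union>F) B (\<lambda>x. case (t, x) of (t, x) \<Rightarrow> ?H t x)"
        using nad by (auto simp: preserves_nad_def)
    qed
  qed
qed

end

context cw_maps
begin

text \<open>On the cell the homotopy relative to the boundary is transported by \<open>psi\<close>,
  elsewhere it is constant. Staying in the \<open>nad_target\<close> of the centre makes it respect
  every \<open>A i\<close> that meets the open cell.\<close>

lemma homotopic_over_insert_cell:
  assumes F: "finite F" "closed_cells F" "e \<in> F" and F': "closed_cells (F - {e})"
    and bd: "chi e ` disc_boundary (d e) \<subseteq> \<Union>(F - {e})"
    and f: "f \<in> topspace maps" and g: "g \<in> topspace maps"
    and eq: "\<And>x. x \<in> \<Union>(F - {e}) \<Longrightarrow> f x = g x"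
    and hom: "homotopic_with (\<lambda>h. \<forall>v\<in>disc_boundary (d e). h v = f (chi e v)) (disc (d e))
      (nad_target n A Y B (chi e (\<lambda>i. 0))) (\<lambda>v. f (chi e v)) (\<lambda>v. g (chi e v))"
  shows "homotopic_over F f g"
proof -
  let ?Z = "nad_target n A Y B (chi e (\<lambda>i. 0))"
  have FE: "F \<subseteq> E"
    using F(2) by (simp add: closed_cells_def)
  then have eE: "e \<in> E"
    using F(3) by blast
  obtain k where k: "continuous_map (top_of_set ({0..1::real} \<times> disc_set (d e))) ?Z k"
    and k0: "\<And>v. v \<in> disc_set (d e) \<Longrightarrow> k (0, v) = f (chi e v)"
    and k1: "\<And>v. v \<in> disc_set (d e) \<Longrightarrow> k (1, v) = g (chi e v)"
    and kb: "\<And>t v. t \<in> {0..1} \<Longrightarrow> v \<in> disc_boundary (d e) \<Longrightarrow> k (t, v) = f (chi e v)"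
    using hom unfolding homotopic_with_rel_disc_boundary by metis
  have kY: "continuous_map (top_of_set ({0..1} \<times> disc_set (d e))) Y k"
    using k unfolding nad_target_def by (rule continuous_map_into_fulltopology)
  define H where "H = (\<lambda>(t, x). if x \<in> \<Union>(F - {e}) then f x else k (t, psi e x))"
  have in_e: "\<exists>v. v \<in> vspace (d e) \<and> vnorm (d e) v < 1 \<and> x = chi e v \<and> psi e x = v \<and> x \<in> e"
    if "x \<in> \<Union>F" "x \<notin> \<Union>(F - {e})" for x
  proof -
    have "x \<in> e"
      using that by blast
    then show ?thesis
      using cell_point[OF eE] psi_chi[OF eE] by metis
  qed
  have H_chi: "H (t, chi e v) = k (t, v)" if t: "t \<in> {0..1}" and v: "v \<in> disc_set (d e)" for t v
  proof (cases "v \<in> disc_boundary (d e)")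
    case True
    then have "chi e v \<in> \<Union>(F - {e})"
      using bd by blast
    then show ?thesis
      using kb[OF t True] by (simp add: H_def)
  next
    case False
    then have w: "v \<in> vspace (d e)" "vnorm (d e) v < 1"
      using v by (auto simp: disc_set_eq)
    then have "chi e v \<notin> \<Union>(F - {e})"
      using in_closed_cells[OF F' eE chi_in_cell[OF eE w]] by blast
    then show ?thesis
      using psi_chi[OF eE w] by (auto simp: H_def)
  qed
  show ?thesis
    unfolding homotopic_over_iff[OF F(2)]
  proof (intro exI[of _ H] conjI ballI)
    show "continuous_map (prod_topology (top_of_set {0..1}) (subtopology X (\<Union>F))) Y H"
    proof (rule continuous_map_cylinder[OF F(1,2)])
      fix c assume c: "c \<in> F"
      show "continuous_map (top_of_set ({0..1} \<times> disc_set (d c))) Y (\<lambda>(t, v). H (t, chi c v))"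
      proof (cases "c = e")
        case True
        show ?thesis
          unfolding True using kY by (rule continuous_map_eq) (auto simp: H_chi)
      next
        case False
        then have "chi c ` disc_set (d c) \<subseteq> \<Union>(F - {e})"
          using c closed_cellsD[OF F'] by blast
        then have Hf: "H (t, chi c v) = f (chi c v)" if "v \<in> disc_set (d c)" for t v
          using that by (auto simp: H_def)
        have "continuous_map (top_of_set (disc_set (d c))) Y (\<lambda>v. f (chi c v))"
          using continuous_map_compose[OF continuous_map_chi mapsD(1)[OF f], of c] c FE
          by (auto simp: o_def disc_eq)
        then have "continuous_map (top_of_set ({0..1::real} \<times> disc_set (d c))) Y (\<lambda>q. f (chi c (snd q)))"
          by (rule continuous_map_compose_on) (auto intro!: continuous_on_snd continuous_on_id)
        then show ?thesis
          by (rule continuous_map_eq) (auto simp: Hf)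
      qed
    qed
  next
    fix x assume x: "x \<in> \<Union>F"
    show "H (0, x) = f x"
    proof (cases "x \<in> \<Union>(F - {e})")
      case False
      then obtain v where "v \<in> vspace (d e)" "vnorm (d e) v < 1" "x = chi e v"
        using in_e[OF x] by blast
      then show ?thesis
        using H_chi[of 0 v] k0[of v] open_disc_subset by simp
    qed (simp add: H_def)
    show "H (1, x) = g x"
    proof (cases "x \<in> \<Union>(F - {e})")
      case True
      then show ?thesis
        using eq by (simp add: H_def)
    next
      case False
      then obtain v where "v \<in> vspace (d e)" "vnorm (d e) v < 1" "x = chi e v"
        using in_e[OF x] by blast
      then show ?thesis
        using H_chi[of 1 v] k1[of v] open_disc_subset by simp
    qed
  next
    fix t :: real assume t: "t \<in> {0..1}"
    show "preserves_nad n (\<lambda>i. A i \<inter> \<Union>F) B (\<lambda>x. H (t, x))"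
      unfolding preserves_nad_def
    proof (intro allI impI image_subsetI)
      fix i x assume i: "i < n" and x: "x \<in> A i \<inter> \<Union>F"
      show "H (t, x) \<in> B i"
      proof (cases "x \<in> \<Union>(F - {e})")
        case True
        then show ?thesis
          using mapsD(3)[OF f i] x by (simp add: H_def)
      next
        case False
        then obtain v where v: "v \<in> vspace (d e)" "vnorm (d e) v < 1" "x = chi e v" "x \<in> e"
          using in_e[of x] x by blast
        have "chi e ` disc_set (d e) \<subseteq> A i"
          using cell_subset_if_meets[OF i eE v(4)] x by blast
        then have "chi e (\<lambda>i. 0) \<in> A i"
          using zero_in_disc_set by blast
        moreover have "k (t, v) \<in> topspace ?Z"
          using k t open_disc_subset[OF v(1,2)] by (auto simp: continuous_map_def Pi_iff)
        ultimately show ?thesis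
          using i H_chi[OF t open_disc_subset[OF v(1,2)]] v(3) by (simp add: nad_target_def)
      qed
    qed
  qed
qed

text \<open>A map is moved by homotopy extension until it equals a representative \<open>s\<close>
  on all cells but one; the maps equal to \<open>s\<close> there are then sorted by their
  restrictions to the last cell. Each step multiplies the number of representatives by at most
  \<open>\<mu>\<close>. They are maps on all of \<open>X\<close>, so classes over
  \<open>\<Union>F\<close> that do not extend never appear.\<close>

lemma homotopy_class_representatives:
  fixes \<mu> :: "'e rel"
  assumes \<mu>: "Cinfinite \<mu>"
    and target: "\<And>x. x \<in> topspace X \<Longrightarrow> homotopy_groups_le (nad_target n A Y B x) \<mu>"
    and F: "finite F" "closed_cells F"
  shows "\<exists>S\<subseteq>topspace maps. |S| \<le>o \<mu> \<and> (\<forall>f\<in>topspace maps. \<exists>s\<in>S. homotopic_over F f s)"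
  using F
proof (induction "card F" arbitrary: F rule: less_induct)
  case (less F)
  show ?case
  proof (cases "F = {}")
    case True
    have hom: "homotopic_over F f s" if "f \<in> topspace maps" for f s
      unfolding homotopic_over_def True
      by (rule homotopic_with_equal) (auto simp: preserves_nad_def intro: continuous_map_from_subtopology mapsD(1)[OF that])
    show ?thesis
    proof (cases "topspace maps = {}")
      case True
      show ?thesis
        by (rule exI[of _ "{}"]) (use True countable_card_of_ordLeq[OF \<mu>, of "{} :: ('a \<Rightarrow> 'b) set"] in auto)
    next
      case False
      then obtain s where "s \<in> topspace maps" by blast
      then show ?thesis
        using hom card_of_singleton_ordLeq[OF \<mu>, of s] by (intro exI[of _ "{s}"]) auto
    qed
  next
    case False
    have FE: "F \<subseteq> E"
      using less.prems(2) by (simp add: closed_cells_def)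
    obtain e where e: "e \<in> F" "\<And>c. c \<in> F \<Longrightarrow> d c \<le> d e"
    proof -
      have "Max (d ` F) \<in> d ` F"
        using less.prems(1) False by (intro Max_in) auto
      then obtain e where "e \<in> F" "d e = Max (d ` F)" by auto
      then show thesis
        using that[of e] less.prems(1) by simp
    qed
    then have eE: "e \<in> E"
      using FE by blast
    \<comment> \<open>By maximality of \<open>d e\<close> no boundary point of a cell of
      \<open>F\<close> lies in \<open>e\<close>, so the remaining cells still form a subcomplex; the
      case \<open>c = e\<close> covers the attaching map of \<open>e\<close>.\<close>
    have bdy: "chi c ` disc_boundary (d c) \<subseteq> \<Union>(F - {e})" if c: "c \<in> F" for c
    proof (rule image_subsetI)
      fix v assume v: "v \<in> disc_boundary (d c)"
      have cE: "c \<in> E"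
        using c FE by blast
      obtain c' where c': "c' \<in> E" "d c' < d c" "chi c v \<in> c'"
        using chi_boundary_lower[OF cE v] .
      have "chi c v \<in> \<Union>F"
        using closed_cellsD[OF less.prems(2) c] v disc_boundary_subset by blast
      then have "c' \<in> F"
        using in_closed_cells[OF less.prems(2) c'(1,3)] by blast
      moreover have "c' \<noteq> e"
        using c'(2) e(2)[OF c] by auto
      ultimately show "chi c v \<in> \<Union>(F - {e})"
        using c'(3) by blast
    qed
    have F': "closed_cells (F - {e})"
      unfolding closed_cells_def
    proof (intro conjI ballI)
      fix c assume c: "c \<in> F - {e}"
      then have "chi c ` disc_set (d c) = c \<union> chi c ` disc_boundary (d c)"
        using chi_disc[of c] FE by blast
      then show "chi c ` disc_set (d c) \<subseteq> \<Union>(F - {e})"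
        using bdy[of c] c by auto
    qed (use FE in auto)
    have "card (F - {e}) < card F"
      using less.prems(1) e(1) by (intro card_Diff1_less)
    then obtain S where S: "S \<subseteq> topspace maps" "|S| \<le>o \<mu>"
        "\<And>f. f \<in> topspace maps \<Longrightarrow> \<exists>s\<in>S. homotopic_over (F - {e}) f s"
      using less.hyps[OF _ _ F'] less.prems(1) by (meson finite_Diff)
    define x0 where "x0 = chi e (\<lambda>i. 0)"
    let ?Z = "nad_target n A Y B x0"
    have x0: "x0 \<in> topspace X" "x0 \<in> e"
      using chi_in_topspace[OF eE zero_in_disc_set] chi_in_cell[OF eE, of "\<lambda>i. 0"]
      by (auto simp: x0_def vspace_def L2_set_def)
    have into_Z: "continuous_map (disc (d e)) ?Z (\<lambda>v. f (chi e v))" if f: "f \<in> topspace maps" for f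
      unfolding nad_target_def
    proof (rule continuous_map_into_subtopology)
      show "continuous_map (disc (d e)) Y (\<lambda>v. f (chi e v))"
        using continuous_map_compose[OF continuous_map_chi[OF eE] mapsD(1)[OF f]] by (simp add: o_def)
      show "(\<lambda>v. f (chi e v)) \<in> topspace (disc (d e)) \<rightarrow> {y. \<forall>i<n. x0 \<in> A i \<longrightarrow> y \<in> B i}"
        using cell_subset_if_meets[OF _ eE x0(2)] mapsD(3)[OF f] by fastforce
    qed
    let ?J = "\<lambda>s. {f \<in> topspace maps. \<forall>x\<in>\<Union>(F - {e}). f x = s x}"
    let ?rel = "\<lambda>s f g. homotopic_with (\<lambda>h. \<forall>v\<in>disc_boundary (d e). h v = s (chi e v)) (disc (d e)) ?Z
        (\<lambda>v. f (chi e v)) (\<lambda>v. g (chi e v))"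
    have "\<exists>J\<subseteq>?J s. |J| \<le>o \<mu> \<and> (\<forall>f\<in>?J s. \<exists>g\<in>J. ?rel s f g)" for s
    proof (rule disc_maps_representatives[OF \<mu> target[OF x0(1)], of "?J s" "d e"
          "\<lambda>f v. f (chi e v)" "\<lambda>v. s (chi e v)"])
      show "continuous_map (disc (d e)) ?Z (\<lambda>v. f (chi e v))" if "f \<in> ?J s" for f
        using that into_Z by simp
      show "f (chi e v) = s (chi e v)" if "f \<in> ?J s" "v \<in> disc_boundary (d e)" for f v
        using that bdy[OF e(1)] by blast
      fix J assume "J \<subseteq> ?J s" "|J| \<le>o \<mu>" "\<And>f. f \<in> ?J s \<Longrightarrow> \<exists>g\<in>J. ?rel s f g"
      then show ?thesis
        by (intro exI[of _ J] conjI ballI)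
    qed
    then have "\<forall>s. \<exists>J. J \<subseteq> ?J s \<and> |J| \<le>o \<mu> \<and> (\<forall>f\<in>?J s. \<exists>g\<in>J. ?rel s f g)"
      by simp
    from choice[OF this] obtain J where J: "\<forall>s. J s \<subseteq> ?J s \<and> |J s| \<le>o \<mu> \<and>
        (\<forall>f\<in>?J s. \<exists>g\<in>J s. ?rel s f g)" ..
    show ?thesis
    proof (intro exI[of _ "\<Union>s\<in>S. J s"] conjI ballI)
      show "(\<Union>s\<in>S. J s) \<subseteq> topspace maps"
        using J by auto
      show "|\<Union>s\<in>S. J s| \<le>o \<mu>"
        using S(2) J \<mu> by (intro UNION_Cinfinite_bound) auto
      fix f assume f: "f \<in> topspace maps"
      obtain s where s: "s \<in> S" "homotopic_over (F - {e}) f s"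
        using S(3)[OF f] by blast
      obtain f' where f': "f' \<in> topspace maps" "\<And>x. x \<in> \<Union>(F - {e}) \<Longrightarrow> f' x = s x"
          "homotopic_over F f f'"
        using homotopy_extension[OF F' f s(2)] less.prems by metis
      have "f' \<in> ?J s"
        using f'(1,2) by blast
      with conjunct2[OF conjunct2[OF spec[OF J, of s]]] have "\<exists>g\<in>J s. ?rel s f' g"
        by (rule bspec)
      then obtain g where g: "g \<in> J s" "?rel s f' g" ..
      have "g \<in> ?J s"
        using g(1) conjunct1[OF spec[OF J, of s]] by (rule subsetD[rotated])
      then have g': "g \<in> topspace maps" "\<And>x. x \<in> \<Union>(F - {e}) \<Longrightarrow> g x = s x"
        by blast+
      have "homotopic_over F f' g"
      proof (rule homotopic_over_insert_cell[OF less.prems e(1) F' bdy[OF e(1)] f'(1) g'(1)])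
        show "f' x = g x" if "x \<in> \<Union>(F - {e})" for x
          using f'(2)[OF that] g'(2)[OF that] by simp
        have "s (chi e v) = f' (chi e v)" if "v \<in> disc_boundary (d e)" for v
          using f'(2) bdy[OF e(1)] that by (metis image_subset_iff)
        then show "homotopic_with (\<lambda>h. \<forall>v\<in>disc_boundary (d e). h v = f' (chi e v)) (disc (d e))
            (nad_target n A Y B (chi e (\<lambda>i. 0))) (\<lambda>v. f' (chi e v)) (\<lambda>v. g (chi e v))"
          using g(2) unfolding x0_def[symmetric] by (elim homotopic_with_mono) simp
      qed
      then have "homotopic_over F f g"
        using f'(3) homotopic_over_trans by blast
      then show "\<exists>g\<in>\<Union>s\<in>S. J s. homotopic_over F f g"
        using s(1) g(1) by blast
    qed
  qed
qed

lemma card_path_components_maps: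
  fixes \<kappa> :: "'c rel" and \<mu> :: "'e rel"
  assumes \<kappa>: "Cinfinite \<kappa>" "|E| \<le>o \<kappa>" and \<mu>: "Cinfinite \<mu>"
    and target: "\<And>x. x \<in> topspace X \<Longrightarrow> homotopy_groups_le (nad_target n A Y B x) \<mu>"
    and Z: "has_cw_type TYPE('w) maps"
  shows "|path_components_of maps| \<le>o \<kappa> *c \<mu>"
proof -
  let ?\<F> = "{F. finite F \<and> closed_cells F}"
  have "\<forall>F\<in>?\<F>. \<exists>S. S \<subseteq> topspace maps \<and> |S| \<le>o \<mu> \<and> (\<forall>f\<in>topspace maps. \<exists>s\<in>S. homotopic_over F f s)"
    using homotopy_class_representatives[OF \<mu> target] by simp
  from bchoice[OF this] obtain S where S: "\<forall>F\<in>?\<F>. S F \<subseteq> topspace maps \<and> |S F| \<le>o \<mu> \<and>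
      (\<forall>f\<in>topspace maps. \<exists>s\<in>S F. homotopic_over F f s)" ..
  have comp_sub: "f \<in> topspace maps" if "C \<in> path_components_of maps" "f \<in> C" for C f
    using path_components_of_subset[OF that(1)] that(2) by blast
  have "\<exists>F f s. F \<in> ?\<F> \<and> f \<in> C \<and> s \<in> S F \<and> homotopic_over F f s \<and>
      (\<forall>g\<in>topspace maps. (\<forall>x\<in>\<Union>F. g x = f x) \<longrightarrow> g \<in> C)" if C: "C \<in> path_components_of maps" for C
  proof -
    obtain f where f: "f \<in> C"
      using nonempty_path_components_of[OF C] by blast
    obtain T where T: "finite T" "\<And>K U. (K, U) \<in> T \<Longrightarrow> compactin X K \<and> openin Y U \<and> f ` K \<subseteq> U"
      "\<And>g. g \<in> topspace maps \<Longrightarrow> (\<And>K U. (K, U) \<in> T \<Longrightarrow> g ` K \<subseteq> U) \<Longrightarrow> g \<in> C"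
      using path_component_nad_maps_nhd[OF Z C f] by metis
    have "compactin X (\<Union>(fst ` T))"
      using T(1,2) by (intro compactin_Union) auto
    then obtain F where F: "finite F" "closed_cells F" "\<Union>(fst ` T) \<subseteq> \<Union>F"
      by (rule compactin_subcomplex)
    have "g \<in> C" if g: "g \<in> topspace maps" "\<forall>x\<in>\<Union>F. g x = f x" for g
    proof (rule T(3)[OF g(1)])
      fix K U assume KU: "(K, U) \<in> T"
      then have "K \<subseteq> \<Union>(fst ` T)"
        by (intro Union_upper image_eqI[of K fst "(K, U)"]) simp_all
      then have "K \<subseteq> \<Union>F"
        using F(3) by (rule subset_trans)
      then have "g ` K = f ` K"
        using g(2) by (intro image_cong) auto
      then show "g ` K \<subseteq> U"
        using T(2)[OF KU] by simp
    qed
    moreover obtain s where "s \<in> S F" "homotopic_over F f s"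
    proof -
      have "\<exists>s\<in>S F. homotopic_over F f s"
        using S F(1,2) comp_sub[OF C f] by simp
      then show thesis
        using that by blast
    qed
    ultimately show ?thesis
      using F(1,2) f by (intro exI[of _ F] exI[of _ f] exI[of _ s]) simp
  qed
  then have "\<forall>C\<in>path_components_of maps. \<exists>q. fst q \<in> ?\<F> \<and> fst (snd q) \<in> C \<and> snd (snd q) \<in> S (fst q) \<and>
      homotopic_over (fst q) (fst (snd q)) (snd (snd q)) \<and>
      (\<forall>g\<in>topspace maps. (\<forall>x\<in>\<Union>(fst q). g x = fst (snd q) x) \<longrightarrow> g \<in> C)"
    by simp
  from bchoice[OF this] obtain q where q: "\<forall>C\<in>path_components_of maps. fst (q C) \<in> ?\<F> \<and>
      fst (snd (q C)) \<in> C \<and> snd (snd (q C)) \<in> S (fst (q C)) \<and>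
      homotopic_over (fst (q C)) (fst (snd (q C))) (snd (snd (q C))) \<and>
      (\<forall>g\<in>topspace maps. (\<forall>x\<in>\<Union>(fst (q C)). g x = fst (snd (q C)) x) \<longrightarrow> g \<in> C)" ..
  define F f s where "F = fst \<circ> q" and "f = fst \<circ> snd \<circ> q" and "s = snd \<circ> snd \<circ> q"
  have F: "finite (F C)" "closed_cells (F C)" and f: "f C \<in> C" and s: "s C \<in> S (F C)"
    and fs: "homotopic_over (F C) (f C) (s C)"
    and agree': "\<forall>g\<in>topspace maps. (\<forall>x\<in>\<Union>(F C). g x = f C x) \<longrightarrow> g \<in> C"
    if "C \<in> path_components_of maps" for C
    using bspec[OF q that] by (simp_all add: F_def f_def s_def)
  have agree: "g \<in> C" if "C \<in> path_components_of maps" "g \<in> topspace maps"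
      "\<And>x. x \<in> \<Union>(F C) \<Longrightarrow> g x = f C x" for C g
    using agree'[OF that(1)] that(2,3) by blast
  have C\<nu>: "Cinfinite (\<kappa> *c \<mu>)"
    using \<kappa>(1) \<mu> Cinfinite_cprod2 Cinfinite_Cnotzero by blast
  show ?thesis
  proof (rule card_of_ordLeq_inj)
    show "inj_on (\<lambda>C. (F C, s C)) (path_components_of maps)"
    proof (rule inj_onI)
      fix C D assume C: "C \<in> path_components_of maps" and D: "D \<in> path_components_of maps"
        and "(F C, s C) = (F D, s D)"
      then have FD: "F C = F D" and sD: "s C = s D" by auto
      have "homotopic_over (F D) (s D) (f D)"
        using fs[OF D] by (rule homotopic_over_sym)
      then have hom: "homotopic_over (F D) (f C) (f D)"
        using fs[OF C] unfolding FD sD by (rule homotopic_over_trans[rotated])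
      \<comment> \<open>Moving \<open>f C\<close> along the homotopy through the common
        representative stays in \<open>C\<close>, yet ends at a map that equals \<open>f D\<close>
        on the cells deciding membership in \<open>D\<close>.\<close>
      obtain f' where f': "f' \<in> topspace maps" "\<And>x. x \<in> \<Union>(F D) \<Longrightarrow> f' x = f D x"
          "path_component_of maps (f C) f'"
        using homotopy_extension[OF F(2)[OF D] comp_sub[OF C f[OF C]] hom] by metis
      have "f' \<in> D"
        using f'(1,2) by (rule agree[OF D])
      moreover have "f' \<in> C"
      proof -
        obtain T where "path_connectedin maps T" "f C \<in> T" "f' \<in> T"
          using f'(3) by (auto simp: path_component_of)
        then show ?thesis
          using path_components_of_maximal[OF C, of T] f[OF C] by (auto simp: disjnt_iff)
      qed
      ultimately show "C = D"
        using path_components_of_overlap[OF C D] by blast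
    qed
    \<comment> \<open>A dependent sum: there are at most \<open>\<kappa>\<close> finite sets of
      cells, and over each lie at most \<open>\<mu>\<close> representatives.\<close>
    show "(\<lambda>C. (F C, s C)) ` path_components_of maps \<subseteq> Sigma ?\<F> S"
      using F s by auto
    have "|?\<F>| \<le>o |Fpow E|"
      by (rule card_of_mono1) (auto simp: Fpow_def closed_cells_def)
    then have "|?\<F>| \<le>o \<kappa>"
      using card_of_Fpow_ordLeq[OF \<kappa>] by (rule ordLeq_transitive)
    moreover have "\<kappa> \<le>o \<kappa> *c \<mu>"
      using ordLeq_cprod2[OF Cinfinite_Cnotzero[OF \<mu>], of \<kappa>] \<kappa>(1) cprod_com[of \<mu> \<kappa>]
      by (blast intro: ordLeq_ordIso_trans)
    ultimately have 1: "|?\<F>| \<le>o \<kappa> *c \<mu>"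
      by (rule ordLeq_transitive)
    have "\<mu> \<le>o \<kappa> *c \<mu>"
      using ordLeq_cprod2[OF Cinfinite_Cnotzero[OF \<kappa>(1)], of \<mu>] \<mu> by blast
    then have "\<forall>F\<in>?\<F>. |S F| \<le>o \<kappa> *c \<mu>"
      using S ordLeq_transitive by blast
    with 1 C\<nu> show "|Sigma ?\<F> S| \<le>o \<kappa> *c \<mu>"
      by (intro card_of_Sigma_ordLeq_infinite_Field) (auto simp: cinfinite_def)
  qed
qed

end

theorem proposition2p3p4:
  fixes X :: "'a topology" and E :: "'a set set" and d :: "'a set \<Rightarrow> nat"
    and n :: nat and A :: "nat \<Rightarrow> 'a set"
    and Y :: "'b topology" and B :: "nat \<Rightarrow> 'b set"
    and \<xi> \<eta> :: "'o rel" and \<kappa> :: "'c rel" and \<mu> :: "'e rel"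
  assumes "cw_nad X E d n A"
    and "nad Y n B"
    and "has_cw_nad_type TYPE('v) n Y B"
    and "has_cw_type TYPE('w) (nad_maps n X A Y B)"
    and "is_aleph \<xi> \<kappa>"
    and "|E| =o \<kappa>"
  shows "(is_aleph \<eta> \<mu> \<and>
          homotopy_groups_le Y \<mu> \<and>
          (\<forall>x\<in>topspace X. homotopy_groups_le (nad_target n A Y B x) \<mu>) \<longrightarrow>
            |path_components_of (nad_maps n X A Y B)| \<le>o \<kappa> *c \<mu> \<and>
            is_aleph (ord_max \<xi> \<eta>) (\<kappa> *c \<mu>)) \<and>
         ((\<exists>E' d'. cw_complex Y E' d' \<and> countable E') \<longrightarrow>
            |path_components_of (nad_maps n X A Y B)| \<le>o \<kappa>)"
proof (intro conjI impI)
  have X: "cw_complex X E d" and A: "\<And>i. i < n \<Longrightarrow> subcomplex X E (A i)"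
    using assms(1) by (auto simp: cw_nad_def)
  have \<kappa>: "Cinfinite \<kappa>" "|E| \<le>o \<kappa>"
    using assms(5,6) ordIso_imp_ordLeq by (auto simp: is_aleph_iff)
  interpret cw_maps X E d n A Y B
    by (intro cw_maps.intro cw.intro cw_maps_axioms.intro X A)
  {
    assume *: "is_aleph \<eta> \<mu> \<and> homotopy_groups_le Y \<mu> \<and>
      (\<forall>x\<in>topspace X. homotopy_groups_le (nad_target n A Y B x) \<mu>)"
    show "|path_components_of (nad_maps n X A Y B)| \<le>o \<kappa> *c \<mu>"
      using * by (intro card_path_components_maps[OF \<kappa> _ _ assms(4)]) (simp_all add: is_aleph_iff)
    show "is_aleph (ord_max \<xi> \<eta>) (\<kappa> *c \<mu>)"
      using * assms(5) by (intro is_aleph_cprod) simp_all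
  next
    assume "\<exists>E' d'. cw_complex Y E' d' \<and> countable E'"
    then show "|path_components_of (nad_maps n X A Y B)| \<le>o \<kappa>"
      using card_path_components_countable_target[OF X _ _ assms(4) \<kappa>] by blast
  }
qed

end
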